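(* Let $n$ be a positive integer. Every skew morphism of the cyclic group $\mathbb{Z}_n$ is smooth if and only if $n=2^e n_1$ for some integer $e$ with $0\le e\le 4$ and some odd square-free positive integer $n_1$.
   Context: All groups are finite. A skew morphism of a group $A$ is a permutation $\varphi$ of $A$ fixing the identity element of $A$ and for which there exists a function $\pi:A\to\mathbb{Z}$ (the power function associated with $\varphi$) such that $\varphi(ab)=\varphi(a)\varphi^{\pi(a)}(b)$ for all $a,b\in A$. The values of $\pi$ are uniquely determined modulo $|\varphi|$, where $|\varphi|$ is the order of the permutation $\varphi$. The skew morphism $\varphi$ is smooth if $\pi(\varphi(a))\equiv\pi(a)\pmod{|\varphi|}$ for all $a\in A$. *)

theory Defs
  imports
    "HOL-Algebra.Bij"
    "HOL-Algebra.Elementary_Groups"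
    "HOL-Algebra.Multiplicative_Group"
    "HOL-Number_Theory.Cong"
    "HOL-Computational_Algebra.Squarefree"
begin

abbreviation perm_order :: "('a, 'b) monoid_scheme \<Rightarrow> ('a \<Rightarrow> 'a) \<Rightarrow> nat" where
  "perm_order G \<phi> \<equiv> group.ord (BijGroup (carrier G)) \<phi>"

definition power_function ::
    "('a, 'b) monoid_scheme \<Rightarrow> ('a \<Rightarrow> 'a) \<Rightarrow> ('a \<Rightarrow> int) \<Rightarrow> bool" where
  "power_function G \<phi> \<pi> \<longleftrightarrow>
     (\<forall>a \<in> carrier G. \<forall>b \<in> carrier G.
        \<phi> (a \<otimes>\<^bsub>G\<^esub> b) = \<phi> a \<otimes>\<^bsub>G\<^esub> (\<phi> [^]\<^bsub>BijGroup (carrier G)\<^esub> \<pi> a) b)"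

text \<open>Permutations of the carrier are extensional functions (value \<open>undefined\<close> off the carrier),
  as in \<open>BijGroup\<close>.\<close>

definition skew_morphism :: "('a, 'b) monoid_scheme \<Rightarrow> ('a \<Rightarrow> 'a) \<Rightarrow> bool" where
  "skew_morphism G \<phi> \<longleftrightarrow>
     \<phi> \<in> carrier (BijGroup (carrier G)) \<and> \<phi> \<one>\<^bsub>G\<^esub> = \<one>\<^bsub>G\<^esub> \<and> (\<exists>\<pi>. power_function G \<phi> \<pi>)"

text \<open>The power function is unique only modulo the order of \<open>\<phi>\<close>, so \<open>\<pi>\<close> is bound existentially
  here; \<open>smooth_iff_all\<close> shows that every power function of \<open>\<phi>\<close> gives the same notion.\<close>

definition smooth :: "('a, 'b) monoid_scheme \<Rightarrow> ('a \<Rightarrow> 'a) \<Rightarrow> bool" where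
  "smooth G \<phi> \<longleftrightarrow> skew_morphism G \<phi> \<and>
     (\<exists>\<pi>. power_function G \<phi> \<pi> \<and>
        (\<forall>a \<in> carrier G. [\<pi> (\<phi> a) = \<pi> a] (mod int (perm_order G \<phi>))))"

lemma carrier_BijGroup: "carrier (BijGroup S) = Bij S"
  by (simp add: BijGroup_def)

lemma power_function_cong:
  assumes G: "group G" and \<phi>: "\<phi> \<in> carrier (BijGroup (carrier G))"
    and \<pi>: "power_function G \<phi> \<pi>" and \<rho>: "power_function G \<phi> \<rho>" and a: "a \<in> carrier G"
  shows "[\<pi> a = \<rho> a] (mod int (perm_order G \<phi>))"
proof -
  interpret G: group G by (fact G)
  interpret B: group "BijGroup (carrier G)" by (rule group_BijGroup)
  let ?p = "\<lambda>k::int. \<phi> [^]\<^bsub>BijGroup (carrier G)\<^esub> k"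
  have Bij: "?p k \<in> Bij (carrier G)" for k
    using B.int_pow_closed[OF \<phi>, of k] unfolding carrier_BijGroup .
  have closed: "?p k b \<in> carrier G" if "b \<in> carrier G" for k b
    using Bij_imp_funcset[OF Bij] that by blast
  have \<phi>a: "\<phi> a \<in> carrier G"
    using Bij_imp_funcset[OF \<phi>[unfolded carrier_BijGroup]] a by blast
  have "?p (\<pi> a) b = ?p (\<rho> a) b" if b: "b \<in> carrier G" for b
  proof -
    have "\<phi> a \<otimes>\<^bsub>G\<^esub> ?p (\<pi> a) b = \<phi> a \<otimes>\<^bsub>G\<^esub> ?p (\<rho> a) b"
      using \<pi>[unfolded power_function_def, rule_format, OF a b]
        \<rho>[unfolded power_function_def, rule_format, OF a b] by (rule subst)
    then show ?thesis
      using closed[OF b] \<phi>a by simp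
  qed
  then have "?p (\<rho> a) = ?p (\<pi> a)"
    by (intro extensionalityI[OF Bij_imp_extensional[OF Bij] Bij_imp_extensional[OF Bij]]) (rule sym)
  then have "int (perm_order G \<phi>) dvd \<pi> a - \<rho> a"
    unfolding B.int_pow_eq[OF \<phi>] .
  then show ?thesis
    unfolding cong_iff_dvd_diff .
qed

lemma smooth_iff_all:
  assumes G: "group G"
  shows "smooth G \<phi> \<longleftrightarrow> skew_morphism G \<phi> \<and>
     (\<forall>\<pi>. power_function G \<phi> \<pi> \<longrightarrow>
        (\<forall>a \<in> carrier G. [\<pi> (\<phi> a) = \<pi> a] (mod int (perm_order G \<phi>))))"
proof (cases "skew_morphism G \<phi>")
  case True
  then have \<phi>: "\<phi> \<in> carrier (BijGroup (carrier G))" and ex: "\<exists>\<pi>. power_function G \<phi> \<pi>"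
    by (auto simp: skew_morphism_def)
  have closed: "\<phi> a \<in> carrier G" if "a \<in> carrier G" for a
    using Bij_imp_funcset[OF \<phi>[unfolded carrier_BijGroup]] that by blast
  have "[\<rho> (\<phi> a) = \<rho> a] (mod int (perm_order G \<phi>))"
    if "power_function G \<phi> \<pi>" "power_function G \<phi> \<rho>" "a \<in> carrier G"
      "[\<pi> (\<phi> a) = \<pi> a] (mod int (perm_order G \<phi>))" for \<pi> \<rho> a
    by (rule cong_trans[OF cong_trans[OF
          power_function_cong[OF G \<phi> that(2,1) closed[OF that(3)]] that(4)]
          power_function_cong[OF G \<phi> that(1-3)]])
  then show ?thesis
    using True ex unfolding smooth_def by blast
qed (simp add: smooth_def)

end

theory Submission
  imports Defs "HOL-Number_Theory.Residues"
begin

text \<open>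
A skew morphism \<open>f\<close> of \<open>\<int>/n\<close> is smooth iff it acts trivially on \<open>\<int>/r\<close>, where \<open>r\<close> is the index of the
kernel \<open>{k. \<pi> k = 1}\<close>. The kernel is invariant and nontrivial, so \<open>f\<close> induces a skew morphism of \<open>\<int>/r\<close>
with the same power function, and one can argue by induction on \<open>n\<close>, showing \<open>\<pi> (f x) = \<pi> x\<close> modulo
each prime power \<open>p^a\<close> exactly dividing the order \<open>m\<close> of \<open>f\<close>. If \<open>p^a\<close> divides the order of \<open>f\<close> on \<open>\<int>/r\<close>,
induction applies. Otherwise \<open>f^(m/p)\<close> is trivial on \<open>\<int>/r\<close>. If \<open>p\<close> does not divide \<open>r\<close>, a Maschke-type
average over \<open>\<int>/r\<close> linearizes \<open>\<pi>\<close>; if \<open>f^(m/p)\<close> moves the kernel, then \<open>\<pi> = 1\<close> modulo \<open>p^a\<close>; in the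
remaining case \<open>p^2\<close> divides \<open>n\<close>, so \<open>p = 2\<close>. The odd part of \<open>\<int>/n\<close> is invariant under \<open>f\<close>, which
reduces to \<open>n = 8\<close> and \<open>n = 16\<close>, where counting the values of \<open>\<pi>\<close> leaves one case to compute.

Conversely, \<open>x \<mapsto> - x + c x (x - 1) / 2\<close> is a skew morphism with \<open>\<pi> x = 1 - 2 x\<close> whenever
\<open>c = n / p\<close> for an odd prime with \<open>p^2\<close> dividing \<open>n\<close>, or \<open>c = n / 4\<close> and 32 divides \<open>n\<close>; its square is
multiplication by \<open>1 + c\<close>, so its order does not divide 4 and it is not smooth.
\<close>

section \<open>Skew maps modulo n\<close>

text \<open>The modulus is an explicit argument, so that the orders of one map on different
  quotients can be compared.\<close>

definition period :: "int \<Rightarrow> (int \<Rightarrow> int) \<Rightarrow> nat" where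
  "period n f = (LEAST i. i > 0 \<and> (\<forall>x. [(f ^^ i) x = x] (mod n)))"

text \<open>Maps on the integers stand for maps on \<open>\<int>/n\<close>, and all equations are congruences. The skew
  morphism induced on a quotient \<open>\<int>/d\<close> is then the same \<open>f\<close> with the modulus \<open>n\<close> replaced by \<open>d\<close>.\<close>

locale cyclic_skew =
  fixes n :: int and f :: "int \<Rightarrow> int" and pw :: "int \<Rightarrow> nat"
  assumes n_pos: "n > 0"
    and f_cong: "[a = b] (mod n) \<Longrightarrow> [f a = f b] (mod n)"
    and f_zero: "[f 0 = 0] (mod n)"
    and f_add: "[f (a + b) = f a + (f ^^ pw a) b] (mod n)"
    and periodic: "\<exists>i>0. \<forall>x. [(f ^^ i) x = x] (mod n)"
begin

abbreviation m :: nat where "m \<equiv> period n f"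

text \<open>This is the power function of the iterate: \<open>f ^^ i\<close> obeys the skew law with
  exponents \<open>tau x i\<close>.\<close>

definition tau :: "int \<Rightarrow> nat \<Rightarrow> nat" where
  "tau x i = (\<Sum>j<i. pw ((f ^^ j) x))"

lemma tau_0 [simp]: "tau x 0 = 0"
  and tau_1: "tau x 1 = pw x"
  and tau_Suc: "tau x (Suc i) = tau x i + pw ((f ^^ i) x)"
  by (simp_all add: tau_def)

lemma tau_add: "tau x (i + j) = tau x i + tau ((f ^^ i) x) j"
  by (induction j) (simp_all add: tau_Suc funpow_add add.commute[of i])

section \<open>Order, iterates and cancellation\<close>

lemma m_pos: "m > 0" and funpow_m: "[(f ^^ m) x = x] (mod n)"
proof -
  have "m > 0 \<and> (\<forall>x. [(f ^^ m) x = x] (mod n))"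
    unfolding period_def by (rule LeastI_ex) (use periodic in blast)
  then show "m > 0" "[(f ^^ m) x = x] (mod n)" by auto
qed

lemma funpow_cong: "[a = b] (mod n) \<Longrightarrow> [(f ^^ i) a = (f ^^ i) b] (mod n)"
  by (induction i) (auto intro: f_cong)

lemma funpow_zero: "[(f ^^ i) 0 = 0] (mod n)"
  by (induction i) (auto intro: cong_trans f_cong f_zero)

lemma funpow_mult_fix:
  assumes "\<And>x. [(f ^^ i) x = x] (mod n)"
  shows "[(f ^^ (i * k)) x = x] (mod n)"
proof (induction k)
  case (Suc k)
  have "(f ^^ (i * Suc k)) x = (f ^^ i) ((f ^^ (i * k)) x)"
    by (simp add: funpow_add)
  then show ?case using assms Suc by (metis cong_trans)
qed simp

lemma fix_iff: "(\<forall>x. [(f ^^ i) x = x] (mod n)) \<longleftrightarrow> m dvd i"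
proof
  assume fixes_all: "\<forall>x. [(f ^^ i) x = x] (mod n)"
  show "m dvd i"
  proof (rule ccontr)
    assume "\<not> m dvd i"
    then have pos: "i mod m > 0" by (simp add: dvd_eq_mod_eq_0)
    have "[(f ^^ (i mod m)) x = x] (mod n)" for x
    proof -
      have "(f ^^ i) x = (f ^^ (i mod m)) ((f ^^ (m * (i div m))) x)"
        by (simp flip: funpow_add comp_apply[of "f ^^ _"])
      moreover have "[(f ^^ (i mod m)) ((f ^^ (m * (i div m))) x) = (f ^^ (i mod m)) x] (mod n)"
        by (intro funpow_cong funpow_mult_fix funpow_m)
      ultimately show ?thesis using fixes_all by (metis cong_sym cong_trans)
    qed
    with pos have "m \<le> i mod m"
      unfolding period_def by (intro Least_le) auto
    then show False using mod_less_divisor[OF m_pos, of i] by simp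
  qed
next
  assume "m dvd i"
  then show "\<forall>x. [(f ^^ i) x = x] (mod n)"
    using funpow_mult_fix[OF funpow_m] by (auto elim: dvdE)
qed

lemma funpow_cancel:
  assumes "[(f ^^ i) a = (f ^^ i) b] (mod n)"
  shows "[a = b] (mod n)"
proof -
  have "(f ^^ (m * i)) x = (f ^^ (m * i - i)) ((f ^^ i) x)" for x
    using m_pos by (simp flip: funpow_add comp_apply[of "f ^^ _"])
  then have "[(f ^^ (m * i)) a = (f ^^ (m * i)) b] (mod n)"
    using funpow_cong[OF assms] by simp
  then show ?thesis
    using funpow_mult_fix[OF funpow_m] by (metis cong_sym cong_trans)
qed

lemma f_cancel: "[f a = f b] (mod n) \<Longrightarrow> [a = b] (mod n)"
  using funpow_cancel[of 1] by simp

lemma funpow_eq_iff: "(\<forall>x. [(f ^^ i) x = (f ^^ j) x] (mod n)) \<longleftrightarrow> [i = j] (mod m)"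
proof -
  have *: "(\<forall>x. [(f ^^ i) x = (f ^^ j) x] (mod n)) \<longleftrightarrow> [i = j] (mod m)" if "i \<le> j" for i j
  proof -
    have "(f ^^ j) x = (f ^^ i) ((f ^^ (j - i)) x)" for x
      using that by (simp flip: funpow_add comp_apply[of "f ^^ _"])
    then have "(\<forall>x. [(f ^^ i) x = (f ^^ j) x] (mod n)) \<longleftrightarrow> (\<forall>x. [(f ^^ (j - i)) x = x] (mod n))"
      by (metis cong_sym funpow_cancel funpow_cong)
    also have "\<dots> \<longleftrightarrow> [i = j] (mod m)"
      unfolding fix_iff using that by (metis cong_altdef_nat cong_sym_eq)
    finally show ?thesis .
  qed
  show ?thesis
    using *[of i j] *[of j i] by (metis cong_sym_eq nat_le_linear)
qed

lemma funpow_exp_cong: "[i = j] (mod m) \<Longrightarrow> [(f ^^ i) x = (f ^^ j) x] (mod n)"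
  using funpow_eq_iff by blast

section \<open>Translations acting on exponents\<close>

lemma funpow_plus: "[(f ^^ i) (a + b) = (f ^^ i) a + (f ^^ tau a i) b] (mod n)"
proof (induction i)
  case (Suc i)
  have "[f ((f ^^ i) (a + b)) = f ((f ^^ i) a + (f ^^ tau a i) b)] (mod n)"
    by (rule f_cong[OF Suc])
  also have "[f ((f ^^ i) a + (f ^^ tau a i) b) =
      f ((f ^^ i) a) + (f ^^ pw ((f ^^ i) a)) ((f ^^ tau a i) b)] (mod n)"
    by (rule f_add)
  finally show ?case
    by (simp add: tau_Suc funpow_add add.commute[of "tau a i"])
qed simp

lemma tau_cong_exp: 
  assumes "\<And>b. [(f ^^ i) b = (f ^^ j) b] (mod n)"
  shows "[tau a i = tau a j] (mod m)"
proof -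
  have "[(f ^^ tau a i) b = (f ^^ tau a j) b] (mod n)" for b
  proof -
    have "[(f ^^ i) a + (f ^^ tau a i) b = (f ^^ j) a + (f ^^ tau a j) b] (mod n)"
      using funpow_plus[of i a b] funpow_plus[of j a b] assms by (metis cong_sym cong_trans)
    then show ?thesis
      using assms[of a] cong_diff by fastforce
  qed
  then show ?thesis using funpow_eq_iff by blast
qed

lemma tau_cong_right: "[i = j] (mod m) \<Longrightarrow> [tau a i = tau a j] (mod m)"
  by (intro tau_cong_exp funpow_exp_cong)

lemma pw_eq_iff: "[pw a = pw b] (mod m) \<longleftrightarrow> (\<forall>y. [f (a + y) - f a = f (b + y) - f b] (mod n))"
proof -
  have "[f (a + y) - f a = (f ^^ pw a) y] (mod n)" for a y
    using cong_diff[OF f_add[of a y] cong_refl[of "f a"]] by simp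
  then show ?thesis
    unfolding funpow_eq_iff[symmetric] by (metis cong_sym cong_trans)
qed

lemma pw_cong_n: "[a = b] (mod n) \<Longrightarrow> [pw a = pw b] (mod m)"
  unfolding pw_eq_iff by (intro allI cong_diff f_cong cong_add cong_refl)

text \<open>Expanding \<open>(f ^^ i) (a + b + y)\<close> with two bracketings shows that the maps
  \<open>tau a\<close> compose as translations do, so each of them permutes the exponents modulo
  \<open>m\<close>.\<close>

lemma tau_comp: "[tau (a + b) i = tau b (tau a i)] (mod m)"
proof -
  have "[(f ^^ tau (a + b) i) y = (f ^^ tau b (tau a i)) y] (mod n)" for y
  proof -
    have "[(f ^^ i) (a + b) + (f ^^ tau (a + b) i) y = (f ^^ i) (a + b + y)] (mod n)"
      by (rule cong_sym[OF funpow_plus])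
    also have "[(f ^^ i) (a + b + y) = (f ^^ i) a + (f ^^ tau a i) (b + y)] (mod n)"
      using funpow_plus[of i a "b + y"] by (simp add: add.assoc)
    also have "[(f ^^ i) a + (f ^^ tau a i) (b + y) =
        (f ^^ i) a + ((f ^^ tau a i) b + (f ^^ tau b (tau a i)) y)] (mod n)"
      by (intro cong_add cong_refl funpow_plus)
    also have "[(f ^^ i) a + ((f ^^ tau a i) b + (f ^^ tau b (tau a i)) y) =
        (f ^^ i) (a + b) + (f ^^ tau b (tau a i)) y] (mod n)"
      unfolding add.assoc[symmetric] by (intro cong_add cong_refl cong_sym[OF funpow_plus])
    finally show ?thesis by (simp add: cong_add_lcancel)
  qed
  then show ?thesis using funpow_eq_iff by blast
qed

lemma pw_add: "[pw (a + b) = tau b (pw a)] (mod m)"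
  using tau_comp[of a b 1] unfolding tau_1 .

lemma pw_zero: "[pw 0 = 1] (mod m)"
proof -
  have "[(f ^^ pw 0) y = (f ^^ 1) y] (mod n)" for y
    using cong_diff[OF cong_sym[OF f_add[of 0 y]] f_zero] by simp
  then show ?thesis using funpow_eq_iff by blast
qed

lemma tau_zero: "[tau 0 i = i] (mod m)"
proof (induction i)
  case (Suc i)
  have "[pw ((f ^^ i) 0) = 1] (mod m)"
    using pw_cong_n[OF funpow_zero] pw_zero by (rule cong_trans)
  with Suc show ?case
    using cong_add[of "tau 0 i" i m "pw ((f ^^ i) 0)" 1] by (simp add: tau_Suc)
qed simp

lemma tau_inverse: "[tau (- a) (tau a i) = i] (mod m)"
  using tau_comp[of a "- a" i] tau_zero[of i] by (metis add.right_inverse cong_sym cong_trans)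

lemma tau_cancel:
  assumes "[tau a i = tau a j] (mod m)"
  shows "[i = j] (mod m)"
  using tau_cong_right[OF assms, of "- a"] tau_inverse by (metis cong_sym cong_trans)

end

section \<open>The kernel and quotients\<close>

context cyclic_skew
begin

lemma funpow_one: "(f ^^ 1) x = f x"
  by simp

text \<open>The injective map \<open>tau b\<close> sends \<open>pw (a - b)\<close> to
  \<open>pw a\<close> and 1 to \<open>pw b\<close>. Hence the kernel is a subgroup and
  \<open>pw\<close> separates exactly its cosets.\<close>

lemma kernel_diff_iff: "[pw (a - b) = 1] (mod m) \<longleftrightarrow> [pw a = pw b] (mod m)"
proof -
  have "[pw a = tau b (pw (a - b))] (mod m)"
    using pw_add[of "a - b" b] by simp
  then have "[pw a = pw b] (mod m) \<longleftrightarrow> [tau b (pw (a - b)) = tau b 1] (mod m)"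
    unfolding tau_1 by (metis cong_sym cong_trans)
  also have "\<dots> \<longleftrightarrow> [pw (a - b) = 1] (mod m)"
    using tau_cancel tau_cong_right by blast
  finally show ?thesis by simp
qed

lemma kernel_f_add:
  assumes "[pw k = 1] (mod m)"
  shows "[f (k + x) = f k + f x] (mod n)"
  using f_add[of k x] funpow_exp_cong[OF assms, of x, unfolded funpow_one]
  by (metis cong_add_lcancel cong_trans)

text \<open>Expand \<open>f (x + k)\<close> with either summand first; a kernel element in front
  makes \<open>f\<close> additive.\<close>

lemma kernel_funpow_pw:
  assumes "[pw k = 1] (mod m)"
  shows "[(f ^^ pw x) k = f k] (mod n)"
proof -
  have "[f x + (f ^^ pw x) k = f x + f k] (mod n)"
    using f_add[of x k] kernel_f_add[OF assms, of x] by (metis add.commute cong_sym cong_trans)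
  then show ?thesis by (simp add: cong_add_lcancel)
qed

text \<open>Compare the two expansions of \<open>f (f k + f x)\<close> given by commutativity.\<close>

lemma kernel_f:
  assumes k: "[pw k = 1] (mod m)"
  shows "[pw (f k) = 1] (mod m)"
proof -
  have *: "[(f ^^ pw (f k)) (f x) = f (f x)] (mod n)" for x
  proof -
    have "[f (f k) + (f ^^ pw (f k)) (f x) = f (f k + f x)] (mod n)"
      by (rule cong_sym[OF f_add])
    also have "[f (f k + f x) = f (f x) + (f ^^ pw (f x)) (f k)] (mod n)"
      using f_add[of "f x" "f k"] by (simp add: add.commute)
    also have "[f (f x) + (f ^^ pw (f x)) (f k) = f (f x) + f (f k)] (mod n)"
      using f_cong[OF kernel_funpow_pw[OF k, of "f x"]]
      by (intro cong_add cong_refl) (simp flip: funpow_swap1)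
    finally show ?thesis by (simp add: add.commute[of "f (f x)"] cong_add_lcancel)
  qed
  have "[(f ^^ pw (f k)) y = (f ^^ 1) y] (mod n)" for y
  proof -
    have y: "[f ((f ^^ (m - 1)) y) = y] (mod n)"
      using funpow_m[of y] m_pos by (metis Suc_pred' comp_apply funpow.simps(2))
    show ?thesis
      using *[of "(f ^^ (m - 1)) y"] funpow_cong[OF y, of "pw (f k)"] f_cong[OF y]
      unfolding funpow_one by (metis cong_sym cong_trans)
  qed
  then show ?thesis using funpow_eq_iff by blast
qed

text \<open>The positive generator of the kernel, viewed as a subgroup of the integers containing
  \<open>n\<close>; hence also its index in Z/n.\<close>

definition r :: int where
  "r = int (LEAST k::nat. k > 0 \<and> [pw (int k) = 1] (mod m))"

lemma r_pos: "r > 0" and kernel_r: "[pw r = 1] (mod m)"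
proof -
  have "\<exists>k::nat. k > 0 \<and> [pw (int k) = 1] (mod m)"
    using n_pos pw_cong_n[of n 0] pw_zero
    by (intro exI[of _ "nat n"]) (auto simp: cong_def)
  from LeastI_ex[OF this] show "r > 0" "[pw r = 1] (mod m)"
    unfolding r_def by auto
qed

lemma kernel_iff: "[pw k = 1] (mod m) \<longleftrightarrow> r dvd k"
proof
  have mult: "[pw (r * j) = 1] (mod m)" for j
  proof (induction j rule: int_induct[of _ 0])
    case base
    then show ?case using pw_zero by simp
  next
    case (step1 i)
    have "[pw (r * (i + 1)) = pw (r * i)] (mod m)"
      using kernel_diff_iff[of "r * (i + 1)" "r * i"] kernel_r by (simp add: algebra_simps)
    then show ?case using step1(2) by (rule cong_trans)
  next
    case (step2 i)
    have "[pw (r * i) = pw (r * (i - 1))] (mod m)"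
      using kernel_diff_iff[of "r * i" "r * (i - 1)"] kernel_r by (simp add: algebra_simps)
    then show ?case using step2(2) by (metis cong_sym cong_trans)
  qed
  show "r dvd k \<Longrightarrow> [pw k = 1] (mod m)"
    using mult by (auto elim: dvdE)
  assume k: "[pw k = 1] (mod m)"
  have "[pw (k mod r) = 1] (mod m)"
  proof -
    have "[pw k = pw (r * (k div r))] (mod m)"
      using k mult by (metis cong_sym cong_trans)
    then show ?thesis
      unfolding kernel_diff_iff[symmetric] by (simp add: minus_mult_div_eq_mod)
  qed
  moreover have "0 \<le> k mod r" "k mod r < r" using r_pos by auto
  ultimately have "\<not> k mod r > 0"
    using not_less_Least[of "nat (k mod r)" "\<lambda>k. k > 0 \<and> [pw (int k) = 1] (mod m)"]
    unfolding r_def by (auto simp: nat_less_iff)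
  with \<open>0 \<le> k mod r\<close> show "r dvd k" by (auto intro: mod_0_imp_dvd)
qed

lemma pw_cong_iff: "[pw a = pw b] (mod m) \<longleftrightarrow> [a = b] (mod r)"
  unfolding kernel_diff_iff[symmetric] kernel_iff cong_iff_dvd_diff ..

lemma r_dvd_n: "r dvd n"
  unfolding kernel_iff[symmetric] using pw_cong_n[of n 0] pw_zero
  by (metis cong_0_iff cong_trans dvd_refl)

lemma r_dvd_f: "r dvd k \<Longrightarrow> r dvd f k"
  using kernel_f kernel_iff by blast

section \<open>Invariant subgroups and the action on the kernel\<close>

lemma quotient:
  assumes "d > 0" "d dvd n" and inv: "\<And>x. d dvd x \<Longrightarrow> d dvd f x"
  shows "cyclic_skew d f pw"
proof
  have inv_pow: "d dvd (f ^^ i) x" if "d dvd x" for i x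
    using that by (induction i) (auto intro: inv)
  show "[f 0 = 0] (mod d)"
    using inv[of 0] by (simp add: cong_0_iff)
  show "[f (a + b) = f a + (f ^^ pw a) b] (mod d)" for a b
    using f_add assms(2) by (rule cong_dvd_modulus)
  show "[f a = f b] (mod d)" if "[a = b] (mod d)" for a b
  proof -
    \<comment> \<open>Write \<open>a\<close> as \<open>b + (a - b)\<close>; iterates map the second
      summand into the invariant subgroup.\<close>
    have "[f (b + (a - b)) = f b + (f ^^ pw b) (a - b)] (mod d)"
      using f_add assms(2) by (rule cong_dvd_modulus)
    moreover have "[(f ^^ pw b) (a - b) = 0] (mod d)"
      using that by (simp add: inv_pow cong_0_iff cong_iff_dvd_diff)
    ultimately have "[f (b + (a - b)) = f b + 0] (mod d)"
      by (meson cong_add_lcancel cong_trans)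
    then show ?thesis by simp
  qed
  show "\<exists>i>0. \<forall>x. [(f ^^ i) x = x] (mod d)"
    using m_pos funpow_m assms(2) by (metis cong_dvd_modulus)
qed (rule assms)

lemma period_dvd:
  assumes "cyclic_skew d f pw" "d dvd n"
  shows "period d f dvd m"
  using cyclic_skew.fix_iff[OF assms(1), of m] funpow_m assms(2) by (metis cong_dvd_modulus)

lemma skew_r: "cyclic_skew r f pw"
  by (rule quotient[OF r_pos r_dvd_n r_dvd_f])

lemma f_cong_r: "[a = b] (mod r) \<Longrightarrow> [(f ^^ i) a = (f ^^ i) b] (mod r)"
  by (rule cyclic_skew.funpow_cong[OF skew_r])

text \<open>The kernel is generated by \<open>r\<close> and \<open>f\<close> is additive on it, so
  \<open>f\<close> acts there as multiplication by \<open>s\<close>.\<close>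

definition s :: int where "s = f r div r"

lemma f_kernel:
  assumes "r dvd k"
  shows "[f k = s * k] (mod n)"
proof -
  have fr: "f r = s * r" using r_dvd_f[of r] by (simp add: s_def)
  have step: "[f (r * i + r) = f (r * i) + s * r] (mod n)" for i
    using kernel_f_add[of "r * i" r] unfolding kernel_iff fr by simp
  have "[f (r * j) = s * (r * j)] (mod n)" for j
  proof (induction j rule: int_induct[of _ 0])
    case base
    then show ?case using f_zero by simp
  next
    case (step1 i)
    have "[f (r * i) + s * r = s * (r * i) + s * r] (mod n)"
      using step1(2) by (intro cong_add) auto
    from cong_trans[OF step[of i] this] show ?case by (simp add: algebra_simps)
  next
    case (step2 i)
    have "[f (r * (i - 1)) + s * r = f (r * i)] (mod n)"
      using step[of "i - 1"] by (simp add: algebra_simps cong_sym)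
    also have "[f (r * i) = s * (r * (i - 1)) + s * r] (mod n)"
      using step2(2) by (simp add: algebra_simps)
    finally show ?case by (simp add: cong_add_rcancel)
  qed
  with assms show ?thesis by (auto elim: dvdE)
qed

lemma funpow_kernel:
  assumes "r dvd k"
  shows "[(f ^^ i) k = s ^ i * k] (mod n)"
proof (induction i)
  case (Suc i)
  have "[f ((f ^^ i) k) = f (s ^ i * k)] (mod n)" by (rule f_cong[OF Suc])
  also have "[f (s ^ i * k) = s * (s ^ i * k)] (mod n)"
    using assms by (intro f_kernel) auto
  finally show ?case by (simp add: mult.assoc)
qed simp

lemma kernel_funpow_add:
  assumes "r dvd k"
  shows "[(f ^^ i) (k + x) = (f ^^ i) k + (f ^^ i) x] (mod n)"
proof -
  have "[tau k i = i] (mod m)"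
  proof (induction i)
    case (Suc i)
    have "r dvd (f ^^ i) k" using assms by (induction i) (auto intro: r_dvd_f)
    then have "[pw ((f ^^ i) k) = 1] (mod m)" unfolding kernel_iff .
    from cong_add[OF Suc this] show ?case by (simp add: tau_Suc)
  qed simp
  from funpow_exp_cong[OF this, of x] funpow_plus[of i k x] show ?thesis
    by (metis cong_add_lcancel cong_trans)
qed

text \<open>The orbit of the generator 1 has full length. With \<open>g = gcd l m\<close>, the
  exponent \<open>t = tau 1 g\<close> is a multiple of \<open>g\<close>; so a point \<open>b\<close>
  fixed by \<open>f ^^ g\<close> is fixed by \<open>f ^^ t\<close>, and then \<open>b + 1\<close> is
  fixed by \<open>f ^^ g\<close>.\<close>

lemma period_dvd_orbit:
  assumes "[(f ^^ l) 1 = 1] (mod n)"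
  shows "m dvd l"
proof (cases "l = 0")
  case False
  define g where "g = gcd l m"
  have pow1: "[(f ^^ (l * j)) 1 = 1] (mod n)" for j
  proof (induction j)
    case (Suc j)
    have "(f ^^ (l * Suc j)) 1 = (f ^^ l) ((f ^^ (l * j)) 1)" by (simp add: funpow_add)
    with funpow_cong[OF Suc, of l] assms show ?case by (metis cong_trans)
  qed simp
  obtain x y where xy: "l * x = m * y + g"
    using bezout_nat[OF False, of m] unfolding g_def by blast
  have g1: "[(f ^^ g) 1 = 1] (mod n)"
  proof -
    have "(f ^^ (l * x)) 1 = (f ^^ (m * y)) ((f ^^ g) 1)" by (simp add: xy funpow_add)
    then show ?thesis
      using pow1[of x] funpow_mult_fix[OF funpow_m, of y "(f ^^ g) 1"]
      by (metis cong_sym cong_trans)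
  qed
  have g: "g dvd m" "g > 0" using m_pos by (auto simp: g_def)
  define t where "t = tau 1 g"
  have shift: "[(f ^^ (g * j)) (1 + y) = 1 + (f ^^ (t * j)) y] (mod n)" for j y
  proof (induction j)
    case (Suc j)
    have "[(f ^^ g) ((f ^^ (g * j)) (1 + y)) = (f ^^ g) (1 + (f ^^ (t * j)) y)] (mod n)"
      by (rule funpow_cong[OF Suc])
    also have "[(f ^^ g) (1 + (f ^^ (t * j)) y) = (f ^^ g) 1 + (f ^^ t) ((f ^^ (t * j)) y)] (mod n)"
      unfolding t_def by (rule funpow_plus)
    also have "[(f ^^ g) 1 + (f ^^ t) ((f ^^ (t * j)) y) = 1 + (f ^^ t) ((f ^^ (t * j)) y)] (mod n)"
      using g1 by (simp add: cong_add_rcancel)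
    finally show ?case by (simp add: funpow_add)
  qed simp
  \<comment> \<open>At \<open>j = m div g\<close> the left side of \<open>shift\<close> applies
    \<open>f ^^ m\<close>, so the iterate on the right is trivial as well.\<close>
  have "[(f ^^ (t * (m div g))) y = y] (mod n)" for y
    using shift[of "m div g" y] funpow_m[of "1 + y"] g
    by (metis cong_add_lcancel cong_sym cong_trans dvd_mult_div_cancel)
  then have "m dvd t * (m div g)" using fix_iff by blast
  then have "g * (m div g) dvd t * (m div g)" using g by simp
  moreover have "m div g > 0" using g m_pos by (simp add: dvd_imp_le div_greater_zero_iff)
  ultimately have "g dvd t" by simp
  have "[(f ^^ g) (int b) = int b] (mod n)" for b
  proof (induction b)
    case 0
    then show ?case using funpow_zero by simp
  next
    case (Suc b)
    have fixes_mult: "[(f ^^ (g * j)) (int b) = int b] (mod n)" for j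
    proof (induction j)
      case (Suc j)
      have "(f ^^ (g * Suc j)) (int b) = (f ^^ g) ((f ^^ (g * j)) (int b))"
        by (simp add: funpow_add)
      with funpow_cong[OF Suc, of g] \<open>[(f ^^ g) (int b) = int b] (mod n)\<close> show ?case
        by (metis cong_trans)
    qed simp
    have "[(f ^^ t) (int b) = int b] (mod n)"
      using \<open>g dvd t\<close> fixes_mult by (auto elim: dvdE)
    then have "[1 + (f ^^ t) (int b) = 1 + int b] (mod n)" by (simp add: cong_add_lcancel)
    with shift[of 1 "int b", unfolded mult_1_right] have "[(f ^^ g) (1 + int b) = 1 + int b] (mod n)"
      by (rule cong_trans)
    then show ?case by simp
  qed
  then have "[(f ^^ g) x = x] (mod n)" for x
  proof -
    have x: "[x = int (nat (x mod n))] (mod n)" using n_pos by (simp add: cong_def)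
    with funpow_cong[OF x, of g] \<open>\<And>b. [(f ^^ g) (int b) = int b] (mod n)\<close>[of "nat (x mod n)"]
    show ?thesis by (metis cong_sym cong_trans)
  qed
  then have "m dvd g" using fix_iff by blast
  then show ?thesis unfolding g_def by simp
qed simp

section \<open>Bounds from counting orbit points and values of the power function\<close>

lemma orbit_inj: "inj_on (\<lambda>i. (f ^^ i) 1 mod n) {..<m}"
proof -
  have "i = j" if "i \<le> j" "j < m" "[(f ^^ i) 1 = (f ^^ j) 1] (mod n)" for i j
  proof -
    have "(f ^^ j) 1 = (f ^^ i) ((f ^^ (j - i)) 1)"
      using that(1) by (simp flip: funpow_add comp_apply[of "f ^^ _"])
    with that(3) have "[1 = (f ^^ (j - i)) 1] (mod n)" by (metis funpow_cancel)
    then have "m dvd j - i" by (intro period_dvd_orbit) (rule cong_sym)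
    with that show ?thesis by (auto dest: dvd_imp_le)
  qed
  then show ?thesis
    unfolding inj_on_def cong_def[symmetric] by (metis cong_sym lessThan_iff nat_le_linear)
qed

lemma pw_inj: "inj_on (\<lambda>x. pw x mod m) {0..<r}"
  by (auto simp: inj_on_def cong_def dest!: pw_cong_iff[unfolded cong_def, THEN iffD1])

lemma r_le_card:
  assumes "finite T" "\<And>x. pw x mod m \<in> T"
  shows "r \<le> int (card T)"
proof -
  have "card {0..<r} \<le> card T"
    using assms by (intro card_inj_on_le[OF pw_inj]) auto
  then show ?thesis by simp
qed

lemma m_le_card:
  assumes "finite T" "\<And>i. (f ^^ i) 1 mod n \<in> T"
  shows "m \<le> card T"
  using card_inj_on_le[OF orbit_inj, of T] assms by auto

lemma m_less_n:
  assumes "n > 1"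
  shows "int m < n"
proof -
  have "(f ^^ i) 1 mod n \<noteq> 0" for i
  proof
    assume "(f ^^ i) 1 mod n = 0"
    then have "[(f ^^ i) 1 = (f ^^ i) 0] (mod n)"
      using funpow_zero[of i] by (simp add: cong_def)
    then have "[1 = 0] (mod n)" by (rule funpow_cancel)
    with assms show False by (simp add: cong_def)
  qed
  then have "m \<le> card {1..<n}"
    using n_pos by (intro m_le_card) (auto simp: int_one_le_iff_zero_less order.not_eq_order_implies_strict)
  then show ?thesis using assms by simp
qed

text \<open>The \<open>r\<close> cosets of the kernel need \<open>r\<close> different exponents
  modulo \<open>m\<close>, and \<open>m < n\<close>. So the kernel is nontrivial, which drives the
  inductions on \<open>n\<close>.\<close>

lemma r_less_n:
  assumes "n > 1"
  shows "r < n"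
proof -
  have "r \<le> int (card {..<m})"
    using m_pos by (intro r_le_card) auto
  with m_less_n[OF assms] show ?thesis by simp
qed

text \<open>\<open>pw\<close> depends only on the class modulo \<open>r\<close>, and a fixed
  generator makes \<open>f\<close> the identity on Z/r.\<close>

lemma smooth_if_trivial_mod_r:
  assumes "[f 1 = 1] (mod r)"
  shows "[pw (f x) = pw x] (mod m)"
proof -
  interpret R: cyclic_skew r f pw by (rule skew_r)
  have "period r f dvd 1" using R.period_dvd_orbit[of 1] assms by simp
  then have "[f x = x] (mod r)" using R.fix_iff[of 1] by simp
  then show ?thesis by (simp add: pw_cong_iff)
qed

end

section \<open>Averaging over a subgroup of the kernel quotient\<close>

text \<open>This makes the Teichmueller lift \<open>w\<close> well defined. Each step factors
  \<open>a ^ p - b ^ p\<close> as \<open>a - b\<close> times a sum of \<open>p\<close> terms that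
  agree modulo \<open>p\<close>.\<close>

lemma power_prime_power_cong:
  fixes u v :: int
  assumes "[u = v] (mod int p)"
  shows "[u ^ p ^ k = v ^ p ^ k] (mod int (p ^ Suc k))"
proof (induction k)
  case 0
  then show ?case using assms by simp
next
  case (Suc k)
  define a b where "a = u ^ p ^ k" and "b = v ^ p ^ k"
  have ab: "[a = b] (mod int (p ^ Suc k))" using Suc by (simp add: a_def b_def)
  then have abp: "[a = b] (mod int p)" by (rule cong_dvd_modulus) simp
  have "[(\<Sum>i<p. b ^ (p - Suc i) * a ^ i) = (\<Sum>i<p. b ^ (p - 1))] (mod int p)"
  proof (rule cong_sum)
    fix i assume "i \<in> {..<p}"
    then have "b ^ (p - 1) = b ^ (p - Suc i) * b ^ i" by (simp flip: power_add)
    then show "[b ^ (p - Suc i) * a ^ i = b ^ (p - 1)] (mod int p)"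
      using abp by (simp add: cong_mult cong_pow)
  qed
  then have "int p dvd (\<Sum>i<p. b ^ (p - Suc i) * a ^ i)"
    by (simp add: cong_def mod_0_imp_dvd)
  moreover have "int (p ^ Suc k) dvd a - b" using ab by (simp add: cong_iff_dvd_diff)
  ultimately have "int (p ^ Suc k) * int p dvd a ^ p - b ^ p"
    unfolding power_diff_sumr2 by (intro mult_dvd_mono)
  then show ?case
    by (simp add: cong_iff_dvd_diff a_def b_def ac_simps flip: power_mult)
qed

lemma power_prime_power_cong_nat:
  fixes u v :: nat
  assumes "[u = v] (mod p)"
  shows "[u ^ p ^ k = v ^ p ^ k] (mod p ^ Suc k)"
  using power_prime_power_cong[of "int u" "int v" p k] assms
  by (simp only: cong_int_iff flip: of_nat_power)

lemma fermat_iterated: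
  fixes u :: nat
  assumes "prime p"
  shows "[u ^ p ^ k = u] (mod p)"
proof (induction k)
  case (Suc k)
  have "[v ^ p = v] (mod p)" for v
  proof (cases "p dvd v")
    case True
    then have "p dvd v ^ p" using prime_gt_0_nat[OF assms] by (intro dvd_trans[OF _ dvd_power]) auto
    with True show ?thesis by (simp add: cong_def dvd_eq_mod_eq_0)
  next
    case False
    have "v ^ p = v ^ (p - 1) * v" using prime_gt_0_nat[OF assms] by (simp flip: power_Suc2)
    then show ?thesis
      using cong_mult[OF fermat_theorem[OF assms False] cong_refl[of v]] by simp
  qed
  from cong_trans[OF this Suc] show ?case by (simp add: mult.commute[of p] power_mult)
qed simp

lemma sum_residues_reindex:
  fixes r d :: int and g :: "int \<Rightarrow> 'a::unique_euclidean_semiring"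
  assumes "r > 0" "d dvd r"
    and inj: "\<And>x y. [h x = h y] (mod r) \<Longrightarrow> [x = y] (mod r)"
    and dvd: "\<And>x. d dvd x \<Longrightarrow> d dvd h x"
    and cong: "\<And>x y. [x = y] (mod r) \<Longrightarrow> [g x = g y] (mod q)"
  defines "X \<equiv> {x \<in> {0..<r}. d dvd x}"
  shows "[(\<Sum>x\<in>X. g (h x)) = (\<Sum>x\<in>X. g x)] (mod q)"
proof -
  let ?h = "\<lambda>x. h x mod r"
  have "finite X" unfolding X_def by (rule finite_Collect_conjI) simp
  have "inj_on ?h X"
  proof (rule inj_onI)
    fix x y assume "x \<in> X" "y \<in> X" "h x mod r = h y mod r"
    with inj[of x y] show "x = y" by (simp add: cong_def X_def)
  qed
  moreover have "?h ` X \<subseteq> X"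
  proof
    fix y assume "y \<in> ?h ` X"
    then obtain x where "x \<in> X" "y = h x mod r" by blast
    with dvd_mod[OF dvd \<open>d dvd r\<close>, of x] \<open>r > 0\<close> show "y \<in> X" by (simp add: X_def)
  qed
  ultimately have "bij_betw ?h X X"
    using \<open>finite X\<close> by (simp add: bij_betw_def endo_inj_surj)
  then have "(\<Sum>x\<in>X. g (?h x)) = (\<Sum>x\<in>X. g x)"
    by (rule sum.reindex_bij_betw)
  moreover have "[(\<Sum>x\<in>X. g (h x)) = (\<Sum>x\<in>X. g (?h x))] (mod q)"
    by (intro cong_sum cong) (simp add: cong_def)
  ultimately show ?thesis by simp
qed

lemma card_residues:
  fixes r d :: int
  assumes "r > 0" "d > 0" "d dvd r"
  shows "card {x \<in> {0..<r}. d dvd x} = nat (r div d)"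
proof -
  have "{x \<in> {0..<r}. d dvd x} = (*) d ` {0..<r div d}"
    using assms by (auto simp: zero_le_mult_iff elim!: dvdE)
  moreover have "inj_on ((*) d) {0..<r div d}"
    using assms by (auto simp: inj_on_def)
  ultimately show ?thesis by (simp add: card_image)
qed

context cyclic_skew
begin

lemma tau_cong_left:
  assumes "[x = y] (mod r)"
  shows "[tau x i = tau y i] (mod m)"
  unfolding tau_def using f_cong_r[OF assms] by (intro cong_sum) (simp add: pw_cong_iff)

lemma f_cancel_r: "[f x = f y] (mod r) \<Longrightarrow> [x = y] (mod r)"
  by (rule cyclic_skew.f_cancel[OF skew_r])

end

text \<open>The averages run over the subgroup dZ/rZ, whose order \<open>r div d\<close> is prime to
  \<open>p\<close>. It is applied with \<open>d = 1\<close>, giving all of Z/r, and with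
  \<open>p = 2\<close> to the odd part of Z/r.\<close>

locale averaging = cyclic_skew +
  fixes p :: nat and d :: int
  assumes prime_p: "prime p" and p_dvd: "p dvd period n f"
    and trivial: "\<And>x. [(f ^^ (period n f div p)) x = x] (mod r)"
    and d_pos: "d > 0" and d_dvd: "d dvd r"
    and d_inv: "\<And>x. d dvd x \<Longrightarrow> d dvd f x"
    and index: "\<not> int p dvd r div d"
begin

text \<open>Conjugation by translations acts on the subgroup of order \<open>p\<close> of \<open>\<langle>f\<rangle>\<close> modulo the kernel by the
  character \<open>chi\<close>; \<open>w\<close> is its Teichmueller lift to the modulus \<open>p ^ a\<close>.\<close>

definition l :: nat where "l = m div p"
definition chi :: "int \<Rightarrow> nat" where "chi x = tau x l div l"
definition a :: nat where "a = multiplicity p m"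
definition w :: "int \<Rightarrow> nat" where "w x = chi x ^ p ^ (a - 1)"

lemma m_eq: "m = l * p"
  using p_dvd by (simp add: l_def)

lemma l_pos: "l > 0"
  using m_pos m_eq by auto

lemma tau_l_mult: "[tau x (l * j) = j * tau x l] (mod m)"
proof (induction j)
  case (Suc j)
  have "[tau ((f ^^ l) x) (l * j) = tau x (l * j)] (mod m)"
    unfolding l_def by (rule tau_cong_left[OF trivial])
  with Suc have "[tau ((f ^^ l) x) (l * j) = j * tau x l] (mod m)" by (rule cong_trans[rotated])
  then have "[tau x l + tau ((f ^^ l) x) (l * j) = tau x l + j * tau x l] (mod m)"
    by (intro cong_add cong_refl)
  then show ?case by (simp flip: tau_add)
qed simp

text \<open>The \<open>p\<close> blocks of length \<open>l\<close> add up to \<open>tau x m\<close>,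
  which vanishes modulo \<open>m = l * p\<close>; so a block is divisible by \<open>l\<close> and
  the division in \<open>chi\<close> is exact.\<close>

lemma tau_l: "tau x l = chi x * l"
proof -
  have "[p * tau x l = tau x m] (mod m)"
    using tau_l_mult[of x p] by (simp add: m_eq cong_sym)
  also have "[tau x m = tau x 0] (mod m)"
    by (rule tau_cong_right) (simp add: cong_def)
  finally have "l * p dvd p * tau x l" by (simp add: cong_0_iff flip: m_eq)
  then have "l dvd tau x l" using prime_gt_0_nat[OF prime_p] by (simp add: mult.commute)
  then show ?thesis by (simp add: chi_def)
qed

lemma chi_congI:
  assumes "[tau x l = c * l] (mod m)"
  shows "[chi x = c] (mod p)"
proof -
  have "[chi x * l = c * l] (mod p * l)"
    using assms by (simp add: tau_l m_eq mult.commute)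
  then show ?thesis using l_pos by (simp add: cong_def mod_mult_mult2)
qed

lemma chi_add: "[chi (x + y) = chi x * chi y] (mod p)"
proof (rule chi_congI)
  have "[tau (x + y) l = tau y (l * chi x)] (mod m)"
    using tau_comp[of x y l] by (simp add: tau_l mult.commute)
  also have "[tau y (l * chi x) = chi x * chi y * l] (mod m)"
    using tau_l_mult[of y "chi x"] by (simp add: tau_l mult.assoc)
  finally show "[tau (x + y) l = chi x * chi y * l] (mod m)" .
qed

lemma chi_zero: "[chi 0 = 1] (mod p)"
  by (rule chi_congI) (use tau_zero[of l] in simp)

lemma chi_cong: "[x = y] (mod r) \<Longrightarrow> [chi x = chi y] (mod p)"
  by (rule chi_congI) (use tau_cong_left[of x y l] in \<open>simp add: tau_l\<close>)

text \<open>Shifting the window of \<open>l\<close> summands by one trades \<open>pw x\<close> for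
  \<open>pw ((f ^^ l) x)\<close>, which is congruent to it.\<close>

lemma chi_f: "[chi (f x) = chi x] (mod p)"
proof (rule chi_congI)
  have "pw x + tau (f x) l = tau x (1 + l)"
    by (subst tau_add) (simp add: tau_1[unfolded One_nat_def])
  also have "\<dots> = tau x l + pw ((f ^^ l) x)"
    by (simp add: tau_Suc)
  finally have "[pw x + tau (f x) l = tau x l + pw ((f ^^ l) x)] (mod m)" by simp
  also have "[tau x l + pw ((f ^^ l) x) = tau x l + pw x] (mod m)"
    using trivial[of x] by (intro cong_add cong_refl) (simp add: pw_cong_iff l_def)
  finally have "[pw x + tau (f x) l = pw x + tau x l] (mod m)" by (simp add: add.commute)
  then show "[tau (f x) l = chi x * l] (mod m)" by (simp add: cong_add_lcancel_nat tau_l)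
qed

lemma a_pos: "a > 0"
  using m_pos p_dvd prime_p unfolding a_def
  by (subst prime_multiplicity_gt_zero_iff) auto

lemma P_dvd: "p ^ a dvd m"
  by (simp add: a_def multiplicity_dvd)

lemma w_congI: "[chi x = c] (mod p) \<Longrightarrow> [w x = c ^ p ^ (a - 1)] (mod p ^ a)"
  using power_prime_power_cong_nat[of "chi x" c p "a - 1"] a_pos by (simp add: w_def)

lemma w_add: "[w (x + y) = w x * w y] (mod p ^ a)"
  using w_congI[OF chi_add] by (simp add: w_def power_mult_distrib)

lemma w_zero: "[w 0 = 1] (mod p ^ a)"
  using w_congI[OF chi_zero] by simp

lemma w_cong: "[x = y] (mod r) \<Longrightarrow> [w x = w y] (mod p ^ a)"
  using w_congI[OF chi_cong] by (simp add: w_def)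

lemma w_f: "[w (f x) = w x] (mod p ^ a)"
  using w_congI[OF chi_f] by (simp add: w_def)

lemma w_inverse: "[w x * w (- x) = 1] (mod p ^ a)"
  using w_add[of x "- x"] w_zero by (metis add.right_inverse cong_sym cong_trans)

lemma w_minus_f: "[w (- f x) = w (- x)] (mod p ^ a)"
proof -
  have "[w (- f x) * (w x * w (- x)) = w (- f x) * 1] (mod p ^ a)"
    by (intro cong_mult cong_refl w_inverse)
  moreover have "[w (- f x) * (w x * w (- x)) = w (- f x) * (w (f x) * w (- x))] (mod p ^ a)"
    by (intro cong_mult cong_refl cong_sym[OF w_f])
  moreover have "[(w (f x) * w (- f x)) * w (- x) = 1 * w (- x)] (mod p ^ a)"
    by (intro cong_mult cong_refl w_inverse)
  ultimately show ?thesis by (simp add: ac_simps) (metis cong_sym cong_trans)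
qed

lemma w_shift: "[w (- x) = w y * w (- (y + x))] (mod p ^ a)"
  using w_add[of y "- (y + x)"] by simp

definition X :: "int set" where "X = {x \<in> {0..<r}. d dvd x}"
text \<open>The Maschke average of the cocycle \<open>tau\<close>, twisted by \<open>w\<close>: it
  turns \<open>tau y\<close> into multiplication by \<open>w y\<close>.\<close>

definition F :: "nat \<Rightarrow> nat" where "F i = (\<Sum>x\<in>X. w (- x) * tau x i)"

lemma tau_cong_P: "[i = j] (mod m) \<Longrightarrow> [i = j] (mod p ^ a)" for i j :: nat
  using cong_dvd_modulus_nat[OF _ P_dvd] .

lemma summand_cong: "[x = y] (mod r) \<Longrightarrow> [w (- x) * tau x i = w (- y) * tau y i] (mod p ^ a)"
  by (intro cong_mult w_cong tau_cong_P tau_cong_left) (simp_all add: cong_minus_minus_iff)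

text \<open>Split off the first summand of \<open>tau\<close>; \<open>f\<close> permutes
  \<open>X\<close> modulo \<open>r\<close> and leaves \<open>w\<close> invariant, so the shifted
  average is \<open>F i\<close> again.\<close>

lemma F_Suc: "[F (Suc i) = F 1 + F i] (mod p ^ a)"
proof -
  have "tau x (Suc i) = tau x 1 + tau (f x) i" for x
    using tau_add[of x 1 i] by simp
  then have Suc: "F (Suc i) = F 1 + (\<Sum>x\<in>X. w (- x) * tau (f x) i)"
    unfolding F_def by (simp add: distrib_left sum.distrib)
  have "[(\<Sum>x\<in>X. w (- x) * tau (f x) i) = (\<Sum>x\<in>X. w (- f x) * tau (f x) i)] (mod p ^ a)"
    by (intro cong_sum cong_mult cong_refl cong_sym[OF w_minus_f])
  also have "[(\<Sum>x\<in>X. w (- f x) * tau (f x) i) = F i] (mod p ^ a)"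
    unfolding F_def X_def
    by (rule sum_residues_reindex[OF r_pos d_dvd f_cancel_r d_inv summand_cong])
  finally show ?thesis unfolding Suc by (intro cong_add cong_refl)
qed

lemma F_linear: "[F i = F 1 * i] (mod p ^ a)"
proof (induction i)
  case (Suc i)
  have "[F 1 + F i = F 1 + F 1 * i] (mod p ^ a)" using Suc by (intro cong_add) auto
  with F_Suc[of i] show ?case by (simp add: cong_trans)
qed (simp add: F_def)

text \<open>Since \<open>tau x (tau y i)\<close> is \<open>tau (y + x) i\<close>, translating the
  summation variable by \<open>y\<close> pulls out the factor \<open>w y\<close>.\<close>

lemma F_tau:
  assumes "d dvd y"
  shows "[F (tau y i) = w y * F i] (mod p ^ a)"
proof -
  have "[F (tau y i) = (\<Sum>x\<in>X. w y * (w (- (y + x)) * tau (y + x) i))] (mod p ^ a)"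
    unfolding F_def mult.assoc[symmetric]
    by (intro cong_sum cong_mult w_shift tau_cong_P cong_sym[OF tau_comp])
  also have "[(\<Sum>x\<in>X. w y * (w (- (y + x)) * tau (y + x) i)) =
      w y * (\<Sum>x\<in>X. w (- (y + x)) * tau (y + x) i)] (mod p ^ a)"
    by (simp add: sum_distrib_left)
  also have "[w y * (\<Sum>x\<in>X. w (- (y + x)) * tau (y + x) i) = w y * F i] (mod p ^ a)"
    unfolding F_def X_def using assms
    by (intro cong_mult cong_refl sum_residues_reindex[OF r_pos d_dvd _ _ summand_cong])
       (auto simp: cong_add_lcancel)
  finally show ?thesis .
qed

text \<open>Modulo \<open>p\<close>, \<open>w (- x)\<close> cancels the factor \<open>chi x\<close>
  of \<open>tau x l\<close>; the other factor \<open>l\<close> lifts this to the modulus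
  \<open>m\<close>.\<close>

lemma F_l: "[F l = card X * l] (mod p ^ a)"
proof -
  have "[w (- x) * tau x l = l] (mod m)" for x
  proof -
    have "[w (- x) * chi x = chi (- x) * chi x] (mod p)"
      unfolding w_def by (intro cong_mult cong_refl fermat_iterated prime_p)
    also have "[chi (- x) * chi x = chi (- x + x)] (mod p)" by (rule cong_sym[OF chi_add])
    also have "[chi (- x + x) = 1] (mod p)" using chi_zero by simp
    finally have "[w (- x) * chi x * l = 1 * l] (mod p * l)"
      by (simp add: cong_def mod_mult_mult2)
    then show ?thesis by (simp add: tau_l m_eq ac_simps)
  qed
  then have "[F l = (\<Sum>x\<in>X. l)] (mod m)" unfolding F_def by (rule cong_sum)
  then show ?thesis by (intro tau_cong_P) simp
qed

text \<open>As \<open>F 1 * l\<close> is \<open>card X * l\<close> with \<open>card X\<close> prime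
  to \<open>p\<close>, a factor \<open>p\<close> in \<open>F 1\<close> would make
  \<open>p ^ a\<close> divide \<open>l\<close>, against the choice of \<open>a\<close> for
  \<open>m = l * p\<close>.\<close>

lemma coprime_F1: "coprime (F 1) (p ^ a)"
proof -
  have "\<not> p dvd F 1"
  proof
    assume "p dvd F 1"
    then have "p * l dvd F 1 * l" by (rule mult_dvd_mono) simp
    then have "p ^ a dvd F 1 * l" using P_dvd m_eq by (metis dvd_trans mult.commute)
    moreover have "[F 1 * l = card X * l] (mod p ^ a)"
      using F_linear[of l] F_l by (metis cong_sym cong_trans)
    ultimately have "p ^ a dvd card X * l" by (simp add: cong_dvd_iff)
    moreover have "coprime (p ^ a) (card X)"
    proof -
      have "\<not> p dvd card X"
        using index d_pos d_dvd r_pos unfolding X_def card_residues[OF r_pos d_pos d_dvd]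
        by (simp add: int_dvd_int_iff[symmetric] pos_imp_zdiv_nonneg_iff del: int_dvd_int_iff)
      then show ?thesis using prime_p by (simp add: prime_imp_coprime_nat)
    qed
    ultimately have "p ^ a dvd l" by (simp add: coprime_dvd_mult_right_iff)
    then have "p ^ Suc a dvd m" unfolding m_eq by (simp add: mult.commute mult_dvd_mono)
    then have "Suc a \<le> multiplicity p m"
      using m_pos prime_p by (intro multiplicity_geI) auto
    then show False by (simp add: a_def)
  qed
  then show ?thesis using prime_p by (simp add: prime_imp_coprime_nat coprime_commute)
qed

lemma tau_linear:
  assumes "d dvd y"
  shows "[tau y i = w y * i] (mod p ^ a)"
proof -
  have "[F 1 * tau y i = F (tau y i)] (mod p ^ a)" by (rule cong_sym[OF F_linear])
  also have "[F (tau y i) = w y * F i] (mod p ^ a)" by (rule F_tau[OF assms])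
  also have "[w y * F i = w y * (F 1 * i)] (mod p ^ a)" by (intro cong_mult cong_refl F_linear)
  finally have "[F 1 * tau y i = F 1 * (w y * i)] (mod p ^ a)" by (simp add: ac_simps)
  then show ?thesis using coprime_F1 by (simp add: cong_mult_lcancel_nat)
qed

lemma pw_eq_w: "d dvd y \<Longrightarrow> [pw y = w y] (mod p ^ a)"
  using tau_linear[of y 1] by (simp only: tau_1 mult_1_right)

lemma pw_f:
  assumes "d dvd x"
  shows "[pw (f x) = pw x] (mod p ^ a)"
  using pw_eq_w[OF assms] pw_eq_w[OF d_inv[OF assms]] w_f by (metis cong_sym cong_trans)

text \<open>Modulo 2 the character \<open>chi\<close> has only the unit 1 as a value.\<close>

lemma pw_eq_1_if_2:
  assumes "p = 2" "d dvd x"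
  shows "[pw x = 1] (mod p ^ a)"
proof -
  have "[chi x * chi (- x) = 1] (mod 2)"
    using chi_add[of x "- x"] chi_zero assms(1) by (metis add.right_inverse cong_sym cong_trans)
  then have "odd (chi x)" by (auto simp: cong_def mod2_eq_if split: if_splits)
  then have "[chi x = 1] (mod p)" using assms(1) by (simp add: cong_def odd_iff_mod_2_eq_one)
  from w_congI[OF this] pw_eq_w[OF assms(2)] show ?thesis by (simp add: cong_trans)
qed

end

section \<open>The 2-part\<close>

text \<open>Applied to orders: an order on a quotient that lacks part of the \<open>p\<close>-power
  in \<open>m\<close> divides \<open>m div p\<close>, so \<open>f ^^ (m div p)\<close> is trivial
  there.\<close>

lemma dvd_div_prime:
  fixes x y p :: nat
  assumes "prime p" "x dvd y" "\<not> p ^ multiplicity p y dvd x"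
  shows "x dvd y div p"
proof -
  obtain k where k: "y = x * k" using assms(2) by (elim dvdE)
  have "p dvd k"
  proof (rule ccontr)
    assume "\<not> p dvd k"
    then have "coprime (p ^ multiplicity p y) k" using assms(1) by (simp add: prime_imp_coprime_nat)
    moreover have "p ^ multiplicity p y dvd x * k" unfolding k[symmetric] by (rule multiplicity_dvd)
    ultimately show False using assms(3) by (simp add: coprime_dvd_mult_left_iff)
  qed
  then obtain k' where "k = p * k'" by (elim dvdE)
  then show ?thesis using prime_gt_0_nat[OF assms(1)] by (simp add: k mult.left_commute)
qed

context cyclic_skew
begin

text \<open>On \<open>X\<close>, of odd order, the defect \<open>D 1 x = f x - s * x\<close> satisfies a cocycle identity; summing it
  over \<open>X\<close> shows that the defect vanishes.\<close>

lemma f_two_part_linear: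
  fixes e g a :: nat and n1 r1 :: int and mo :: nat
  assumes n: "n = 2 ^ e * n1" and r: "r = 2 ^ g * r1" "odd r1" and ge: "g \<le> e"
    and mo: "m = 2 ^ a * mo" "odd mo"
    and inv: "\<And>x. 2 ^ g dvd x \<Longrightarrow> 2 ^ g dvd f x"
    and pw1: "\<And>x. 2 ^ g dvd x \<Longrightarrow> [pw x = 1] (mod 2 ^ a)"
    and x: "2 ^ g dvd x"
  shows "[f x = s * x] (mod 2 ^ e)"
proof (cases "e = g")
  case True
  with inv[OF x] x show ?thesis unfolding cong_iff_dvd_diff by (intro dvd_diff dvd_mult) auto
next
  case False
  have en: "2 ^ e dvd n" by (simp add: n)
  have gr: "2 ^ g dvd r" by (simp add: r)
  \<comment> \<open>\<open>r\<close> is \<open>2 ^ g\<close> times an odd number, so equality of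
    powers of \<open>s\<close> on \<open>r\<close> passes to all multiples of \<open>2 ^ g\<close>,
    modulo \<open>2 ^ e\<close>.\<close>
  have spow: "[s ^ i * y = s ^ j * y] (mod 2 ^ e)"
    if "[(f ^^ i) r = (f ^^ j) r] (mod n)" "2 ^ g dvd y" for i j y
  proof -
    have "[s ^ i * r = s ^ j * r] (mod n)"
      by (rule cong_trans[OF cong_sym[OF funpow_kernel[OF dvd_refl]]
            cong_trans[OF that(1) funpow_kernel[OF dvd_refl]]])
    then have "2 ^ e dvd (s ^ i - s ^ j) * 2 ^ g * r1"
      using en by (simp add: cong_iff_dvd_diff r algebra_simps) (metis dvd_trans)
    moreover have "coprime (2 ^ e) r1" using r(2) by simp
    ultimately have "2 ^ e dvd (s ^ i - s ^ j) * 2 ^ g"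
      by (simp add: coprime_dvd_mult_left_iff)
    also have "(s ^ i - s ^ j) * 2 ^ g dvd (s ^ i - s ^ j) * y"
      using that(2) by (rule mult_dvd_mono[OF dvd_refl])
    finally show ?thesis by (simp add: cong_iff_dvd_diff left_diff_distrib)
  qed
  define X where "X = {x \<in> {0..<r}. 2 ^ g dvd x}"
  define D where "D i y = (f ^^ i) y - s ^ i * y" for i y
  define E where "E i = (\<Sum>y\<in>X. D i y)" for i
  have D_cong: "[D i y = D i z] (mod 2 ^ e)" if "[y = z] (mod r)" for i y z
  proof -
    have k: "r dvd y - z" using that by (simp add: cong_iff_dvd_diff)
    have "[(f ^^ i) (y - z + z) = s ^ i * (y - z) + (f ^^ i) z] (mod n)"
      by (rule cong_trans[OF kernel_funpow_add[OF k, of i z] cong_add[OF funpow_kernel[OF k] cong_refl]])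
    from cong_diff[OF this cong_refl[of "s ^ i * y"]] have "[D i y = D i z] (mod n)"
      by (simp add: D_def algebra_simps)
    then show ?thesis using en by (rule cong_dvd_modulus)
  qed
  have inv_pow: "2 ^ g dvd (f ^^ i) y" if "2 ^ g dvd y" for i y
    using that by (induction i) (auto intro: inv)
  have E_add: "[E (i + j) = E i + s ^ i * E j] (mod 2 ^ e)" for i j
  proof -
    have "D (i + j) y = D i ((f ^^ j) y) + s ^ i * D j y" for y
      by (simp add: D_def funpow_add algebra_simps power_add)
    then have "E (i + j) = (\<Sum>y\<in>X. D i ((f ^^ j) y)) + s ^ i * E j"
      by (simp add: E_def sum.distrib sum_distrib_left)
    moreover have "[(\<Sum>y\<in>X. D i ((f ^^ j) y)) = E i] (mod 2 ^ e)"
      unfolding E_def X_def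
      by (rule sum_residues_reindex[OF r_pos gr cyclic_skew.funpow_cancel[OF skew_r] inv_pow D_cong])
    ultimately show ?thesis by (simp add: cong_add_rcancel)
  qed
  have E_mult: "[E (i * k) = 0] (mod 2 ^ e)" if "[E i = 0] (mod 2 ^ e)" for i k
  proof (induction k)
    case 0
    then show ?case by (simp add: E_def D_def)
  next
    case (Suc k)
    have "[E (i + i * k) = E i + s ^ i * E (i * k)] (mod 2 ^ e)" by (rule E_add)
    also have "[E i + s ^ i * E (i * k) = 0 + s ^ i * 0] (mod 2 ^ e)"
      by (intro cong_add cong_mult cong_refl that Suc)
    finally show ?case by simp
  qed
  have E_m: "[E m = 0] (mod 2 ^ e)"
  proof -
    have "[D m y = 0] (mod 2 ^ e)" if "y \<in> X" for y
    proof -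
      have "[s ^ m * y = y] (mod 2 ^ e)"
        using spow[of m 0 y] funpow_m[of r] that by (simp add: X_def)
      then show ?thesis
        using cong_diff[OF cong_dvd_modulus[OF funpow_m en, of y] \<open>[s ^ m * y = y] (mod 2 ^ e)\<close>]
        by (simp add: D_def)
    qed
    then have "[E m = (\<Sum>y\<in>X. 0)] (mod 2 ^ e)" unfolding E_def by (rule cong_sum)
    then show ?thesis by simp
  qed
  have "odd s"
  proof
    assume "even s"
    have "[s ^ m * 2 ^ g = 2 ^ g] (mod 2 ^ e)"
      using spow[of m 0 "2 ^ g"] funpow_m[of r] by simp
    then have "2 ^ e dvd 2 ^ g * (s ^ m - 1)" by (simp add: cong_iff_dvd_diff algebra_simps)
    moreover have "odd (s ^ m - 1)" using \<open>even s\<close> m_pos by simp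
    then have "coprime (2 ^ e) (s ^ m - 1)" by simp
    ultimately have "(2::int) ^ e dvd 2 ^ g" by (simp add: coprime_dvd_mult_left_iff)
    then have "(2::int) ^ e \<le> 2 ^ g" by (rule zdvd_imp_le) simp
    then show False using ge False by simp
  qed
  \<comment> \<open>Doubling the exponent multiplies \<open>E\<close> by
    \<open>1 + s ^ 2 ^ t\<close>, which is even, so each doubling gains a factor 2.\<close>
  have E_two: "2 ^ t dvd E (2 ^ t)" if "t \<le> e" for t
    using that
  proof (induction t)
    case (Suc t)
    have "[E (2 ^ t + 2 ^ t) = E (2 ^ t) + s ^ 2 ^ t * E (2 ^ t)] (mod 2 ^ Suc t)"
      using E_add by (rule cong_dvd_modulus) (use Suc.prems in \<open>simp add: le_imp_power_dvd del: power_Suc\<close>)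
    moreover have "2 * 2 ^ t dvd (1 + s ^ 2 ^ t) * E (2 ^ t)"
      using \<open>odd s\<close> Suc by (intro mult_dvd_mono) auto
    then have "2 ^ Suc t dvd E (2 ^ t) + s ^ 2 ^ t * E (2 ^ t)" by (simp add: distrib_right)
    ultimately have "2 ^ Suc t dvd E (2 ^ t + 2 ^ t)" using cong_dvd_iff by blast
    moreover have "(2::nat) ^ Suc t = 2 ^ t + 2 ^ t" by simp
    ultimately show ?case by metis
  qed simp
  \<comment> \<open>The exponents where \<open>E\<close> vanishes are closed under gcds;
    \<open>m\<close> and \<open>2 ^ e\<close> are among them, and their gcd divides
    \<open>2 ^ a\<close>.\<close>
  have "[E (2 ^ a) = 0] (mod 2 ^ e)"
  proof -
    define c where "c = gcd m (2 ^ e)"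
    obtain u v where uv: "m * u = 2 ^ e * v + c"
      using bezout_nat[of m "2 ^ e"] m_pos unfolding c_def by auto
    have Ee: "[E (2 ^ e) = 0] (mod 2 ^ e)"
      using E_two[of e] by (simp add: cong_0_iff)
    have "[0 = E (m * u)] (mod 2 ^ e)" by (rule cong_sym[OF E_mult[OF E_m]])
    also have "[E (m * u) = E (2 ^ e * v) + s ^ (2 ^ e * v) * E c] (mod 2 ^ e)"
      unfolding uv by (rule E_add)
    also have "[E (2 ^ e * v) + s ^ (2 ^ e * v) * E c = 0 + s ^ (2 ^ e * v) * E c] (mod 2 ^ e)"
      by (intro cong_add cong_refl E_mult Ee)
    finally have "2 ^ e dvd s ^ (2 ^ e * v) * E c" by (simp add: cong_0_iff cong_sym_eq[of 0])
    moreover have "coprime (2 ^ e) (s ^ (2 ^ e * v))" using \<open>odd s\<close> by simp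
    ultimately have Ec: "[E c = 0] (mod 2 ^ e)"
      by (simp add: coprime_dvd_mult_right_iff cong_0_iff)
    have "coprime c mo"
      using mo(2) by (rule_tac coprime_divisors[of c "2 ^ e" mo mo]) (auto simp: c_def)
    moreover have "c dvd 2 ^ a * mo" unfolding mo(1)[symmetric] by (simp add: c_def)
    ultimately have "c dvd 2 ^ a" by (simp add: coprime_dvd_mult_left_iff)
    then show ?thesis using E_mult[OF Ec] by (auto elim!: dvdE)
  qed
  \<comment> \<open>Adding \<open>m\<close> keeps the iterate and makes the exponent positive, so
    that it is 1 plus a natural multiple of \<open>2 ^ a\<close>.\<close>
  define q where "q = pw x + m"
  have q_pw: "[(f ^^ q) y = (f ^^ pw x) y] (mod n)" for y
    by (rule funpow_exp_cong) (simp add: q_def cong_def)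
  have "[q = 1] (mod 2 ^ a)"
    using pw1[OF x] mo(1) unfolding q_def by (simp add: cong_def)
  moreover have "q \<ge> 1" using m_pos by (simp add: q_def)
  ultimately have "\<exists>k. q = k * 2 ^ a + 1" by (simp only: cong_le_nat)
  then obtain k where k: "q = 1 + 2 ^ a * k" by (auto simp: mult.commute)
  have "[E q = E 1 + s ^ 1 * E (2 ^ a * k)] (mod 2 ^ e)" unfolding k by (rule E_add)
  also have "[E 1 + s ^ 1 * E (2 ^ a * k) = E 1 + s ^ 1 * 0] (mod 2 ^ e)"
    by (intro cong_add cong_mult cong_refl E_mult \<open>[E (2 ^ a) = 0] (mod 2 ^ e)\<close>)
  finally have Eq: "[E q = E 1] (mod 2 ^ e)" by simp
  have "[D 1 (x + y) = D 1 x + D q y] (mod 2 ^ e)" if "y \<in> X" for y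
  proof -
    have "[f (x + y) = f x + (f ^^ q) y] (mod n)"
      using cong_trans[OF f_add cong_add[OF cong_refl cong_sym[OF q_pw]]] .
    then have 1: "[f (x + y) = f x + (f ^^ q) y] (mod 2 ^ e)" using en by (rule cong_dvd_modulus)
    have "[(f ^^ q) r = (f ^^ 1) r] (mod n)"
      using q_pw[of r] kernel_funpow_pw[OF kernel_r, of x] unfolding funpow_one by (rule cong_trans)
    then have "[s ^ q * y = s ^ 1 * y] (mod 2 ^ e)"
      using that by (intro spow) (auto simp: X_def)
    then have 2: "[s * x + s * y = s * x + s ^ q * y] (mod 2 ^ e)"
      by (simp add: cong_add_lcancel cong_sym)
    from cong_diff[OF 1 2] show ?thesis by (simp add: D_def algebra_simps)
  qed
  then have "[(\<Sum>y\<in>X. D 1 (x + y)) = (\<Sum>y\<in>X. D 1 x + D q y)] (mod 2 ^ e)"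
    by (rule cong_sum)
  also have "(\<Sum>y\<in>X. D 1 x + D q y) = int (card X) * D 1 x + E q"
    by (simp add: sum.distrib E_def)
  also have "[int (card X) * D 1 x + E q = int (card X) * D 1 x + E 1] (mod 2 ^ e)"
    using Eq by (simp add: cong_add_lcancel)
  finally have "[(\<Sum>y\<in>X. D 1 (x + y)) = int (card X) * D 1 x + E 1] (mod 2 ^ e)" .
  \<comment> \<open>Translation by \<open>x\<close> permutes \<open>X\<close> modulo
    \<open>r\<close>, so the left sum is \<open>E 1\<close> too and only
    \<open>card X * D 1 x\<close> remains.\<close>
  moreover have "[(\<Sum>y\<in>X. D 1 (x + y)) = E 1] (mod 2 ^ e)"
    unfolding E_def X_def using x
    by (intro sum_residues_reindex[OF r_pos gr _ _ D_cong]) (auto simp: cong_add_lcancel)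
  ultimately have "[int (card X) * D 1 x + E 1 = E 1] (mod 2 ^ e)"
    by (rule cong_trans[OF cong_sym])
  then have "2 ^ e dvd int (card X) * D 1 x"
    by (simp add: cong_add_rcancel_0 cong_0_iff)
  moreover have "odd (int (card X))"
  proof -
    have "card X = nat r1"
      using card_residues[OF r_pos _ gr] by (simp add: X_def r)
    moreover have "r1 > 0" using r_pos r(1) by (simp add: zero_less_mult_iff)
    ultimately show ?thesis using r(2) by simp
  qed
  then have "coprime (2 ^ e) (int (card X))" by simp
  ultimately have "2 ^ e dvd D 1 x" by (simp add: coprime_dvd_mult_right_iff)
  then show ?thesis by (simp add: D_def cong_iff_dvd_diff)
qed

end

text \<open>The multiples of the full power of 2 form the odd part of Z/n. By induction the odd part
  of Z/r is invariant; \<open>pw\<close> is 1 on it by induction or by averaging, and the resulting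
  linearity of \<open>f\<close> makes the odd part of Z/n invariant.\<close>

lemma two_part:
  assumes "cyclic_skew n f pw" "2 ^ multiplicity 2 n dvd x"
  shows "2 ^ multiplicity 2 n dvd f x"
    and "[pw x = 1] (mod 2 ^ multiplicity 2 (period n f))"
proof -
  have "(\<forall>x. 2 ^ multiplicity 2 n dvd x \<longrightarrow>
      2 ^ multiplicity 2 n dvd f x \<and> [pw x = 1] (mod 2 ^ multiplicity 2 (period n f)))"
    using assms(1)
  proof (induction "nat n" arbitrary: n rule: less_induct)
    case less
    interpret cyclic_skew n f pw by (rule less.prems)
    show ?case
    proof (cases "n = 1")
      case True
      then have "m dvd 1" unfolding fix_iff[symmetric] by simp
      with True show ?thesis by simp
    next
      case False
      then have "r < n" using n_pos by (intro r_less_n) simp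
      define e g v where "e = multiplicity 2 n" and "g = multiplicity 2 r" and "v = multiplicity 2 m"
      have IH: "2 ^ g dvd f x" "[pw x = 1] (mod 2 ^ multiplicity 2 (period r f))"
        if "2 ^ g dvd x" for x
        using less.hyps[OF _ skew_r] \<open>r < n\<close> r_pos that by (auto simp: g_def)
      obtain n1 where n1: "n = 2 ^ e * n1"
        using multiplicity_dvd[of 2 n] unfolding e_def by (elim dvdE)
      obtain r1 where r1: "r = 2 ^ g * r1" "odd r1"
        using multiplicity_decompose'[of r 2] r_pos unfolding g_def
        by (metis less_irrefl odd_one)
      obtain mo where mo: "m = 2 ^ v * mo" "odd mo"
        using multiplicity_decompose'[of m 2] m_pos unfolding v_def
        by (metis less_irrefl odd_one)
      have "g \<le> e"
        unfolding g_def e_def using n_pos r_dvd_n by (intro dvd_imp_multiplicity_le) auto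
      have pw1: "[pw x = 1] (mod 2 ^ v)" if "2 ^ g dvd x" for x
      proof (cases "2 ^ v dvd period r f")
        case True
        then have "v \<le> multiplicity 2 (period r f)"
          using cyclic_skew.m_pos[OF skew_r] by (intro multiplicity_geI) auto
        then show ?thesis using IH(2)[OF that] by (meson cong_dvd_modulus_nat le_imp_power_dvd)
      next
        case False
        then have "period r f dvd m div 2"
          unfolding v_def by (intro dvd_div_prime period_dvd skew_r r_dvd_n) auto
        moreover have "2 dvd m"
          using False mo by (cases "v = 0") auto
        moreover have "\<not> 2 dvd r div 2 ^ g" using r1 by simp
        ultimately interpret averaging n f pw 2 "2 ^ g"
          using cyclic_skew.fix_iff[OF skew_r, of "m div 2"] r1 IH(1)
          by unfold_locales auto
        show ?thesis using pw_eq_1_if_2[OF refl that] by (simp add: v_def a_def)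
      qed
      have "2 ^ e dvd f x \<and> [pw x = 1] (mod 2 ^ v)" if "2 ^ e dvd x" for x
      proof
        have gx: "2 ^ g dvd x" using that \<open>g \<le> e\<close> by (meson dvd_trans le_imp_power_dvd)
        have "[f x = s * x] (mod 2 ^ e)"
          by (rule f_two_part_linear[OF n1 r1 \<open>g \<le> e\<close> mo IH(1) pw1 gx])
        then show "2 ^ e dvd f x" using that by (simp add: cong_dvd_iff)
        show "[pw x = 1] (mod 2 ^ v)" by (rule pw1[OF gx])
      qed
      then show ?thesis by (simp add: e_def v_def)
    qed
  qed
  with assms(2) show "2 ^ multiplicity 2 n dvd f x"
    and "[pw x = 1] (mod 2 ^ multiplicity 2 (period n f))" by auto
qed

section \<open>The kernel at a prime dividing the order\<close>

lemma cong_prime_powers_imp_cong: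
  fixes x y k :: nat
  assumes "k > 0" and cong: "\<And>p. prime p \<Longrightarrow> [x = y] (mod p ^ multiplicity p k)"
  shows "[x = y] (mod k)"
proof -
  have *: "[x = y] (mod k)" if "y \<le> x" "\<And>p. prime p \<Longrightarrow> [x = y] (mod p ^ multiplicity p k)" for x y
  proof (cases "x = y")
    case False
    with that(1) have "x - y \<noteq> 0" by simp
    have "k dvd x - y"
    proof (rule multiplicity_le_imp_dvd)
      fix p :: nat assume "prime p"
      then have "p ^ multiplicity p k dvd x - y"
        using that by (simp add: cong_altdef_nat)
      then show "multiplicity p k \<le> multiplicity p (x - y)"
        using \<open>x - y \<noteq> 0\<close> \<open>prime p\<close> by (intro multiplicity_geI) auto
    qed (use assms in simp)
    then show ?thesis using that(1) by (simp add: cong_altdef_nat)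
  qed simp
  show ?thesis
    using *[of y x] *[of x y] cong by (metis cong_sym nat_le_linear)
qed

lemma dvd_two_power:
  fixes d :: int
  assumes "d dvd 2 ^ e" "d > 0"
  obtains g where "d = 2 ^ g"
proof -
  have "nat d dvd 2 ^ e" using assms by (simp add: nat_dvd_iff)
  then obtain g where "nat d = 2 ^ g" using divides_primepow_nat[of 2 "nat d" e] by auto
  then have "d = 2 ^ g" using assms(2) by (metis int_nat_eq less_le of_nat_numeral of_nat_power)
  then show ?thesis by (rule that)
qed

text \<open>Descend to Z/r until the kernel is everything, where \<open>f\<close> is multiplication
  by \<open>s\<close>; parity is visible throughout because the moduli stay even.\<close>

lemma cyclic_skew_even:
  assumes "cyclic_skew n f pw" "n = 2 ^ e" "e > 0" "even x"
  shows "even (f x)"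
  using assms
proof (induction "nat n" arbitrary: n e rule: less_induct)
  case less
  interpret cyclic_skew n f pw by (rule less.prems)
  have "n > 1" unfolding less.prems(2) using less.prems(3) by (rule one_less_power[rotated]) simp
  then have "r < n" by (rule r_less_n)
  have "even n" using less.prems by simp
  show ?case
  proof (cases "r = 1")
    case True
    then have "[f x = s * x] (mod 2)"
      by (intro cong_dvd_modulus[OF f_kernel \<open>even n\<close>]) simp
    with \<open>even x\<close> show ?thesis by (simp add: cong_dvd_iff)
  next
    case False
    obtain g where "r = 2 ^ g"
      using r_dvd_n r_pos unfolding less.prems(2) by (rule dvd_two_power)
    with False have "g > 0" by (cases g) auto
    show ?thesis
      by (rule less.hyps[OF _ skew_r \<open>r = 2 ^ g\<close> \<open>g > 0\<close> \<open>even x\<close>]) (use \<open>r < n\<close> r_pos in simp)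
  qed
qed

context cyclic_skew
begin

text \<open>On the kernel \<open>f ^^ pw x\<close> acts as \<open>f\<close>, so the exponent
  \<open>pw x - 1\<close> fixes it. If that exponent lacked part of the \<open>p\<close>-power in
  \<open>m\<close>, its gcd with \<open>m\<close> would divide \<open>m div p\<close>, and
  \<open>f ^^ (m div p)\<close> would fix the kernel.\<close>

lemma pw_cong_1_if_kernel_moved:
  assumes "prime p" "r dvd k0" "\<not> [(f ^^ (m div p)) k0 = k0] (mod n)"
  shows "[pw x = 1] (mod p ^ multiplicity p m)"
proof -
  \<comment> \<open>This is \<open>pw x - 1\<close> modulo \<open>m\<close>; adding \<open>m\<close>
    prevents truncation when \<open>pw x = 0\<close>.\<close>
  define q where "q = pw x + m - 1"
  have Sq: "Suc q = pw x + m" using m_pos by (simp add: q_def)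
  have fix_q: "[(f ^^ q) k = k] (mod n)" if "r dvd k" for k
  proof (rule f_cancel)
    have "[(f ^^ (pw x + m)) k = (f ^^ pw x) k] (mod n)"
      by (rule funpow_exp_cong) (simp add: cong_def)
    also have "[(f ^^ pw x) k = f k] (mod n)"
      using that by (intro kernel_funpow_pw) (simp add: kernel_iff[unfolded One_nat_def])
    finally show "[f ((f ^^ q) k) = f k] (mod n)"
      unfolding Sq[symmetric] by simp
  qed
  have "p ^ multiplicity p m dvd q"
  proof (rule ccontr)
    assume nd: "\<not> p ^ multiplicity p m dvd q"
    define g where "g = gcd q m"
    have "g dvd m div p"
      using assms(1) by (rule dvd_div_prime) (use nd in \<open>auto simp: g_def\<close>)
    then obtain j where j: "m div p = g * j" by (elim dvdE)
    have "q \<noteq> 0" using nd by (intro notI) simp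
    then obtain u v where uv: "q * u = m * v + g"
      using bezout_nat[of q m] unfolding g_def by blast
    have fix_g: "[(f ^^ g) k = k] (mod n)" if "r dvd k" for k
    proof -
      have "[(f ^^ (q * i)) k = k] (mod n)" for i
      proof (induction i)
        case (Suc i)
        have "[(f ^^ q) ((f ^^ (q * i)) k) = (f ^^ q) k] (mod n)" by (rule funpow_cong[OF Suc])
        from cong_trans[OF this fix_q[OF that]] show ?case by (simp add: funpow_add)
      qed simp
      moreover have "[(f ^^ g) k = (f ^^ (q * u)) k] (mod n)"
        unfolding uv by (rule funpow_exp_cong) (simp add: cong_def)
      ultimately show ?thesis by (rule cong_trans[rotated])
    qed
    have "[(f ^^ (g * i)) k0 = k0] (mod n)" for i
    proof (induction i)
      case (Suc i)
      have "[(f ^^ g) ((f ^^ (g * i)) k0) = (f ^^ g) k0] (mod n)" by (rule funpow_cong[OF Suc])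
      from cong_trans[OF this fix_g[OF assms(2)]] show ?case by (simp add: funpow_add)
    qed simp
    with assms(3) j show False by simp
  qed
  then have "[q + 1 = 0 + 1] (mod p ^ multiplicity p m)"
    by (intro cong_add) (simp_all add: cong_0_iff)
  then have "[Suc q = 1] (mod p ^ multiplicity p m)" by simp
  moreover have "[pw x + m = pw x] (mod p ^ multiplicity p m)"
    using multiplicity_dvd[of p m] by (simp add: cong_add_lcancel_0_nat cong_0_iff)
  ultimately show ?thesis unfolding Sq by (rule cong_trans[OF cong_sym, rotated])
qed

text \<open>The displacement \<open>(f ^^ i) y - y\<close> lies in the kernel and is fixed, so every
  application adds it again.\<close>

lemma funpow_mult_shift:
  assumes "\<And>k. r dvd k \<Longrightarrow> [(f ^^ i) k = k] (mod n)" "r dvd (f ^^ i) y - y"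
  shows "[(f ^^ (i * j)) y = y + int j * ((f ^^ i) y - y)] (mod n)"
proof (induction j)
  case (Suc j)
  define k where "k = (f ^^ i) y - y"
  have rk: "r dvd int j * k" using assms(2) by (simp add: k_def)
  have "[(f ^^ i) ((f ^^ (i * j)) y) = (f ^^ i) (int j * k + y)] (mod n)"
    using Suc by (intro funpow_cong) (simp add: k_def add.commute)
  also have "[(f ^^ i) (int j * k + y) = (f ^^ i) (int j * k) + (f ^^ i) y] (mod n)"
    by (rule kernel_funpow_add[OF rk])
  also have "[(f ^^ i) (int j * k) + (f ^^ i) y = int j * k + (f ^^ i) y] (mod n)"
    by (intro cong_add cong_refl assms(1) rk)
  finally show ?case by (simp add: funpow_add k_def algebra_simps)
qed simp

text \<open>Being trivial on Z/r and on the kernel, the iterate moves 1 by a kernel element of order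
  \<open>p\<close>: \<open>p\<close> repetitions give \<open>f ^^ m\<close>, while the orbit of 1 is
  too long for a single one to fix 1.\<close>

lemma kernel_translation:
  assumes "prime p" "p dvd m"
    and trivial: "\<And>x. [(f ^^ (m div p)) x = x] (mod r)"
    and kernel: "\<And>k. r dvd k \<Longrightarrow> [(f ^^ (m div p)) k = k] (mod n)"
  defines "k \<equiv> (f ^^ (m div p)) 1 - 1"
  shows "r dvd k" "n dvd int p * k" "\<not> n dvd k"
proof -
  show rk: "r dvd k" using trivial[of 1] by (simp add: k_def cong_iff_dvd_diff)
  have "[1 + int p * k = (f ^^ m) 1] (mod n)"
    using funpow_mult_shift[OF kernel, of 1 p] rk assms(2) by (simp add: k_def cong_sym)
  from cong_trans[OF this funpow_m] show "n dvd int p * k"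
    by (simp add: cong_add_lcancel_0 cong_0_iff)
  show "\<not> n dvd k"
  proof
    assume "n dvd k"
    then have "m dvd m div p" by (intro period_dvd_orbit) (simp add: k_def cong_iff_dvd_diff)
    moreover have "0 < m div p" "m div p < m"
      using m_pos assms(1,2) prime_gt_1_nat[OF assms(1)] by (auto simp: dvd_imp_le div_greater_zero_iff prime_gt_0_nat)
    ultimately show False by (auto dest: dvd_imp_le)
  qed
qed

section \<open>Parity and counting in cyclic 2-groups\<close>

lemma pw_nonzero:
  assumes "m > 1"
  shows "pw x mod m \<noteq> 0"
proof
  assume "pw x mod m = 0"
  \<comment> \<open>The injective map \<open>tau x\<close> sends 0 to 0 and 1 to
    \<open>pw x\<close>.\<close>
  then have "[tau x 1 = tau x 0] (mod m)" by (simp only: tau_1 tau_0 cong_def mod_0)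
  then have "[1 = 0] (mod m)" by (rule tau_cancel)
  with assms show False by (simp add: cong_def)
qed

text \<open>An even \<open>s\<close> would send the kernel element of order two to 0.\<close>

lemma odd_s:
  assumes "even (n div r)"
  shows "odd s"
proof
  assume "even s"
  then obtain t where t: "s = 2 * t" by (elim evenE)
  have nr: "n = r * (n div r)" using r_dvd_n by simp
  obtain u where u: "n div r = 2 * u" using assms by (elim evenE)
  have "[f (r * u) = s * (r * u)] (mod n)" by (rule f_kernel) simp
  also have "s * (r * u) = n * t" using nr unfolding t u by (simp add: ac_simps)
  also have "[n * t = f 0] (mod n)"
    using f_zero by (simp add: cong_def)
  finally have "[r * u = 0] (mod n)" by (rule f_cancel)
  then have "r * (u * 2) dvd r * u" using nr u by (simp add: cong_0_iff mult.commute)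
  then have "u * 2 dvd u" using r_pos by simp
  moreover have "r * (2 * u) > 0" using nr n_pos unfolding u by simp
  then have "u > 0" using r_pos by (simp add: zero_less_mult_iff)
  ultimately show False by (auto dest: zdvd_imp_le)
qed

lemma two_power_orbit_odd:
  assumes "n = 2 ^ e" "e > 0" "odd x"
  shows "odd ((f ^^ i) x)"
proof (induction i)
  case (Suc i)
  have "even n" using assms by simp
  interpret Q: cyclic_skew 2 f pw
    using cyclic_skew_even[OF cyclic_skew_axioms assms(1,2)] \<open>even n\<close> by (intro quotient) auto
  show ?case
  proof
    assume "even ((f ^^ Suc i) x)"
    then have "[f ((f ^^ i) x) = f 0] (mod 2)"
      using Q.f_zero by (simp add: cong_0_iff cong_def)
    then have "[(f ^^ i) x = 0] (mod 2)" by (rule Q.f_cancel)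
    with Suc show False by (simp add: cong_0_iff)
  qed
qed (use assms in simp)

text \<open>A kernel of order two is fixed pointwise, so \<open>m\<close> is at most twice the order
  on Z/r; that order is at most \<open>r div 2\<close>, as the orbit of 1 stays odd. Then
  \<open>m\<close> is at most \<open>r\<close>, but \<open>pw\<close> needs \<open>r\<close>
  distinct nonzero values modulo \<open>m\<close>.\<close>

lemma two_power_index:
  assumes n: "n = 2 ^ e" and "even r"
  shows "n \<noteq> 2 * r"
proof
  assume n2: "n = 2 * r"
  interpret R: cyclic_skew r f pw by (rule skew_r)
  have e: "e > 0" "e - 1 > 0"
  proof -
    have "n \<ge> 4" using n2 \<open>even r\<close> r_pos by (auto elim!: evenE)
    have "e \<noteq> 0" using n \<open>n \<ge> 4\<close> by (cases e) auto
    moreover have "e \<noteq> 1"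
    proof
      assume "e = 1"
      with n \<open>n \<ge> 4\<close> show False by simp
    qed
    ultimately show "e > 0" "e - 1 > 0" by simp_all
  qed
  have r2: "r = 2 ^ (e - 1)" using n n2 e(1) by (cases e) auto
  have "n div r = 2"
    using n2 r_pos by (metis less_irrefl nonzero_mult_div_cancel_right)
  then have "odd s" by (intro odd_s) simp
  have fix_k: "[(f ^^ i) k = k] (mod n)" if "r dvd k" for k i
  proof -
    have "[f k = k] (mod n)" if "r dvd k" for k
    proof -
      have "2 * r dvd (s - 1) * k"
        using \<open>odd s\<close> that by (intro mult_dvd_mono) auto
      then have "[s * k = k] (mod n)"
        unfolding n2[symmetric] by (simp add: cong_iff_dvd_diff left_diff_distrib)
      with f_kernel[OF that] show ?thesis by (rule cong_trans)
    qed
    note * = this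
    show ?thesis
      by (induction i) (auto intro: cong_trans[OF f_cong *[OF that]])
  qed
  have "[(f ^^ (R.m * 2)) 1 = 1 + int 2 * ((f ^^ R.m) 1 - 1)] (mod n)"
    using R.funpow_m[of 1] by (intro funpow_mult_shift fix_k) (auto simp: cong_iff_dvd_diff)
  also have "[1 + int 2 * ((f ^^ R.m) 1 - 1) = 1] (mod n)"
  proof -
    have "2 * r dvd 2 * ((f ^^ R.m) 1 - 1)"
      using R.funpow_m[of 1] by (intro mult_dvd_mono) (simp_all add: cong_iff_dvd_diff)
    then show ?thesis unfolding n2[symmetric] by (simp add: cong_iff_dvd_diff)
  qed
  finally have "m dvd R.m * 2" by (rule period_dvd_orbit)
  then have "m \<le> R.m * 2" using R.m_pos by (intro dvd_imp_le) auto
  moreover have "R.m \<le> card ((\<lambda>i. 2 * i + 1) ` {0..<r div 2})"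
  proof (rule R.m_le_card)
    fix i
    have "odd ((f ^^ i) 1 mod r)"
      using R.two_power_orbit_odd[OF r2 e(2), of 1 i] \<open>even r\<close> by (simp add: dvd_mod_iff)
    moreover have "0 \<le> (f ^^ i) 1 mod r" "(f ^^ i) 1 mod r < r" using r_pos by auto
    ultimately show "(f ^^ i) 1 mod r \<in> (\<lambda>i. 2 * i + 1) ` {0..<r div 2}"
      by (intro image_eqI[of _ _ "((f ^^ i) 1 mod r) div 2"]) (auto elim!: oddE \<open>even r\<close>[THEN evenE])
  qed simp
  moreover have "card ((\<lambda>i. 2 * i + 1) ` {0..<r div 2}) \<le> nat (r div 2)"
    by (rule order.trans[OF card_image_le]) auto
  ultimately have "int m \<le> r" using r_pos \<open>even r\<close> by auto
  have "r \<ge> 2" using r_pos \<open>even r\<close> by (auto elim: evenE)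
  moreover have "r \<le> int (card {..<m})" using m_pos by (intro r_le_card) auto
  ultimately have "m > 1" by simp
  have "r \<le> int (card {1..<m})"
    using pw_nonzero[OF \<open>m > 1\<close>] m_pos by (intro r_le_card) (auto simp: Suc_le_eq)
  with \<open>int m \<le> r\<close> \<open>m > 1\<close> show False by simp
qed

end

section \<open>Smoothness\<close>

context cyclic_skew
begin

text \<open>Modulo \<open>r\<close> the orbit of \<open>x\<close> alternates between
  \<open>x\<close> and \<open>f x\<close>.\<close>

lemma tau_odd:
  assumes "[f (f x) = x] (mod r)"
  shows "[tau x (2 * h + 1) = h * (pw x + pw (f x)) + pw x] (mod m)"
proof -
  have "[pw ((f ^^ 2) y) = pw y] (mod m)" if "[y = x] (mod r) \<or> [y = f x] (mod r)" for y
  proof -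
    have "[(f ^^ 2) y = y] (mod r)"
      using that
    proof
      assume y: "[y = x] (mod r)"
      from f_cong_r[OF this, of 2] assms have "[(f ^^ 2) y = x] (mod r)"
        by (simp add: numeral_2_eq_2 cong_trans)
      then show ?thesis using cong_sym[OF y] by (rule cong_trans)
    next
      assume y: "[y = f x] (mod r)"
      from f_cong_r[OF this, of 2] f_cong_r[OF assms, of 1] have "[(f ^^ 2) y = f x] (mod r)"
        by (simp add: numeral_2_eq_2) (rule cong_trans)
      then show ?thesis using cong_sym[OF y] by (rule cong_trans)
    qed
    then show ?thesis by (simp add: pw_cong_iff)
  qed
  have orbit: "[(f ^^ (2 * h)) x = x] (mod r)" for h
  proof (induction h)
    case (Suc h)
    have "[f (f ((f ^^ (2 * h)) x)) = f (f x)] (mod r)"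
      using f_cong_r[OF Suc, of 2] by (simp add: numeral_2_eq_2)
    from cong_trans[OF this assms] show ?case by simp
  qed simp
  show ?thesis
  proof (induction h)
    case (Suc h)
    have "[pw ((f ^^ (2 * h + 1)) x) = pw (f x)] (mod m)"
      using f_cong_r[OF orbit[of h], of 1] by (simp add: pw_cong_iff)
    moreover have "[pw ((f ^^ (2 * h + 2)) x) = pw x] (mod m)"
      using orbit[of "Suc h"] unfolding pw_cong_iff by simp
    moreover have "tau x (2 * Suc h + 1) =
        tau x (2 * h + 1) + (pw ((f ^^ (2 * h + 1)) x) + pw ((f ^^ (2 * h + 2)) x))"
      by (simp add: tau_Suc)
    ultimately have "[tau x (2 * Suc h + 1) =
        h * (pw x + pw (f x)) + pw x + (pw (f x) + pw x)] (mod m)"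
      using Suc by (simp only:) (intro cong_add)
    then show ?case by (simp add: algebra_simps)
  qed (simp add: tau_1[unfolded One_nat_def])
qed

text \<open>If \<open>f\<close> acts as \<open>- 1\<close> modulo 4, then the power function takes the values 3, 5, 7 modulo 8 with
  \<open>pw 2 = 5\<close>, and expanding \<open>f 3\<close> as \<open>f (1 + 2)\<close> and as \<open>f (2 + 1)\<close> gives a contradiction.\<close>

lemma index_four:
  assumes n: "n = 16" and r: "r = 4"
  shows "[f 1 = 1] (mod r)"
proof (rule ccontr)
  assume nontriv: "\<not> [f 1 = 1] (mod r)"
  interpret R: cyclic_skew 4 f pw using skew_r by (simp add: r)
  have even_f: "even (f x)" if "even x" for x
    using cyclic_skew_even[OF cyclic_skew_axioms, of 4 x] that by (simp add: n)
  have odd_pow: "odd ((f ^^ i) x)" if "odd x" for i x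
    using two_power_orbit_odd[of 4 x i] that by (simp add: n)
  have odd_f: "odd (f x)" if "odd x" for x
    using odd_pow[OF that, of 1] by simp
  have f_cong4: "f x mod 4 = f (x mod 4) mod 4" for x
    using R.f_cong[of x "x mod 4"] by (simp add: cong_def)
  have f0: "f 0 mod 4 = 0" using R.f_zero by (simp add: cong_def)
  have f1: "f 1 mod 4 = 3"
    using nontriv odd_f[of 1] unfolding r by (simp add: cong_def) presburger
  have f3: "f 3 mod 4 = 1"
  proof -
    have "f 3 mod 4 \<noteq> f 1 mod 4"
      using R.f_cancel[of 3 1] by (auto simp: cong_def)
    with f1 odd_f[of 3] show ?thesis by presburger
  qed
  have f2: "f 2 mod 4 = 2"
  proof -
    have "f 2 mod 4 \<noteq> f 0 mod 4"
      using R.f_cancel[of 2 0] by (auto simp: cong_def)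
    with f0 even_f[of 2] show ?thesis by presburger
  qed
  have neg: "[f x = - x] (mod 4)" for x
  proof -
    have "x mod 4 \<in> {0, 1, 2, 3}" by auto
    then have "f (x mod 4) mod 4 = (- (x mod 4)) mod 4"
      using f0 f1 f2 f3 by (elim insertE emptyE) simp_all
    moreover have "(- x) mod 4 = (- (x mod 4)) mod 4" by (simp add: mod_minus_eq)
    ultimately show ?thesis unfolding cong_def using f_cong4[of x] by metis
  qed
  have ff: "[f (f x) = x] (mod r)" for x
    using cong_trans[OF neg[of "f x"]] neg[of x] cong_minus_minus_iff[of "f x" "- x" 4]
    by (simp add: r)
  have pow_neg: "[(f ^^ i) x = (- 1) ^ i * x] (mod 4)" for i x
  proof (induction i)
    case (Suc i)
    from cong_trans[OF neg cong_minus_minus_iff[THEN iffD2, OF Suc]] show ?case by simp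
  qed simp
  \<comment> \<open>An even exponent would give \<open>f (x + 1) = - x + 1\<close> modulo 4 instead
    of \<open>- x - 1\<close>.\<close>
  have odd_pw: "odd (pw x)" for x
  proof (rule ccontr)
    assume "\<not> odd (pw x)"
    then have "[(f ^^ pw x) 1 = 1] (mod 4)" using pow_neg[of "pw x" 1] by simp
    then have "[f (x + 1) = - x + 1] (mod 4)"
      using cong_trans[OF R.f_add[of x 1] cong_add[OF neg[of x]]] by blast
    from cong_trans[OF cong_sym[OF neg[of "x + 1"]] this] show False
      by (simp add: cong_iff_dvd_diff)
  qed
  have "odd s" by (rule odd_s) (subst r, subst n, simp)
  have "8 dvd s * s - 1"
  proof -
    obtain u where "s = 2 * u + 1" using \<open>odd s\<close> by (elim oddE)
    then have "s * s - 1 = 4 * (u * (u + 1))" by (simp add: algebra_simps)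
    moreover have "4 * 2 dvd 4 * (u * (u + 1))" by (intro mult_dvd_mono) auto
    ultimately show ?thesis by simp
  qed
  have fix_k: "[(f ^^ 2) k = k] (mod n)" if "r dvd k" for k
  proof -
    have "8 * 4 dvd (s * s - 1) * k" using that \<open>8 dvd s * s - 1\<close> unfolding r by (rule mult_dvd_mono[rotated])
    then have "16 dvd (s * s - 1) * k" by (rule dvd_trans[rotated]) simp
    then have "[s ^ 2 * k = k] (mod n)"
      by (simp add: n cong_iff_dvd_diff power2_eq_square left_diff_distrib)
    with funpow_kernel[OF that] show ?thesis by (rule cong_trans)
  qed
  \<comment> \<open>The displacement under \<open>f ^^ 2\<close>; it lies in the kernel, which
    \<open>f ^^ 2\<close> fixes, so iterates become linear in \<open>T\<close>.\<close>
  define T where "T y = f (f y) - y" for y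
  have rT: "r dvd T y" for y using ff[of y] by (simp add: T_def cong_iff_dvd_diff)
  have f_even: "[(f ^^ (2 * j)) y = y + int j * T y] (mod n)" for j y
    using funpow_mult_shift[OF fix_k, of y j] rT[of y] by (simp add: T_def numeral_2_eq_2)
  have f_odd: "[(f ^^ (2 * j + 1)) y = f y + int j * (s * T y)] (mod n)" for j y
  proof -
    have "[f ((f ^^ (2 * j)) y) = f (int j * T y + y)] (mod n)"
      using f_cong[OF f_even[of j y]] by (simp add: add.commute)
    also have "[f (int j * T y + y) = f (int j * T y) + f y] (mod n)"
      using kernel_funpow_add[of "int j * T y" 1 y] rT[of y] by simp
    also have "[f (int j * T y) + f y = s * (int j * T y) + f y] (mod n)"
      using rT[of y] by (intro cong_add cong_refl f_kernel) simp
    finally show ?thesis by (simp add: algebra_simps)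
  qed
  have "[(f ^^ 8) 1 = 1] (mod n)"
  proof -
    have "4 * 4 dvd 4 * T 1" using rT[of 1] unfolding r by (intro mult_dvd_mono) auto
    then have "[1 + 4 * T 1 = 1] (mod n)" by (simp add: n cong_iff_dvd_diff)
    with f_even[of 4 1] show ?thesis by (simp add: cong_trans)
  qed
  then have "m dvd 2 ^ 3" using period_dvd_orbit[of 8] by simp
  then obtain i where i: "i \<le> 3" "m = 2 ^ i"
    unfolding divides_primepow_nat[OF two_is_prime_nat] by blast
  \<comment> \<open>With \<open>m\<close> dividing 8, only \<open>m = 8\<close> leaves room for four
    distinct values of \<open>pw\<close> modulo \<open>m\<close>, all odd.\<close>
  have "m = 8"
  proof (rule ccontr)
    assume "m \<noteq> 8"
    with i have "m = 1 \<or> m = 2 \<or> m = 4"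
      by (auto simp: le_Suc_eq numeral_3_eq_3 numeral_2_eq_2)
    moreover have "pw x mod m \<in> {0, 1}" if "m = 1 \<or> m = 2" for x
      using that by auto
    moreover have "pw x mod m \<in> {1, 3}" if "m = 4" for x
      using that odd_pw[of x] by simp presburger
    ultimately show False
      using r_le_card[of "{0, 1}"] r_le_card[of "{1, 3}"] r by auto
  qed
  obtain z where z: "T 1 = 4 * z" using rT[of 1] unfolding r by (elim dvdE)
  have "odd z"
  proof
    assume "even z"
    then have "[1 + 2 * T 1 = 1] (mod n)"
      by (auto simp: n z cong_iff_dvd_diff elim!: evenE)
    with f_even[of 2 1] have "[(f ^^ 4) 1 = 1] (mod n)" by (simp add: cong_trans)
    then have "m dvd 4" by (rule period_dvd_orbit)
    with \<open>m = 8\<close> show False by (simp add: nat_dvd_not_less)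
  qed
  \<comment> \<open>Oddness and distinctness leave 3, 5, 7 in some order; \<open>f\<close> exchanges
    the classes of 1 and 3 modulo 4.\<close>
  define a b c where "a = pw 1 mod 8" and "b = pw 2 mod 8" and "c = pw 3 mod 8"
  have abc: "a mod 8 = a" "b mod 8 = b" "c mod 8 = c" "odd a" "odd b" "odd c"
    using odd_pw by (simp_all add: a_def b_def c_def dvd_mod_iff)
  have pw_mod: "pw x mod 8 = pw y mod 8 \<longleftrightarrow> x mod 4 = y mod 4" for x y
    using pw_cong_iff[of x y] unfolding \<open>m = 8\<close> r cong_def .
  have "a \<noteq> 1" "b \<noteq> 1" "c \<noteq> 1" "a \<noteq> b" "a \<noteq> c" "b \<noteq> c"
    using pw_mod[of 1 0] pw_mod[of 2 0] pw_mod[of 3 0] pw_mod[of 1 2] pw_mod[of 1 3] pw_mod[of 2 3]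
      pw_zero[unfolded \<open>m = 8\<close>] by (auto simp: a_def b_def c_def cong_def)
  have pw_f1: "pw (f 1) mod 8 = c" and pw_f3: "pw (f 3) mod 8 = a"
    using pw_mod[of "f 1" 3] pw_mod[of "f 3" 1] f1 f3 by (auto simp: a_def c_def)
  obtain h where h: "a = 2 * h + 1" using \<open>odd a\<close> by (elim oddE)
  obtain h' where h': "c = 2 * h' + 1" using \<open>odd c\<close> by (elim oddE)
  have "b = (h * (a + c) + a) mod 8"
  proof -
    have "[pw 2 = tau 1 (pw 1)] (mod m)" using pw_add[of 1 1] by simp
    also have "[tau 1 (pw 1) = tau 1 a] (mod m)"
      by (rule tau_cong_right) (simp add: a_def \<open>m = 8\<close>)
    also have "[tau 1 a = h * (pw 1 + pw (f 1)) + pw 1] (mod m)"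
      unfolding h by (rule tau_odd[OF ff])
    also have "[h * (pw 1 + pw (f 1)) + pw 1 = h * (a + c) + a] (mod m)"
      using pw_f1 abc(3) by (intro cong_add cong_mult cong_refl) (simp_all add: a_def \<open>m = 8\<close> cong_def)
    finally show ?thesis by (simp add: b_def cong_def \<open>m = 8\<close>)
  qed
  moreover have "b = (h' * (c + a) + c) mod 8"
  proof -
    \<comment> \<open>The class of 2 modulo 4 is also that of \<open>3 + 3\<close>, which gives a
      second formula for \<open>b\<close>.\<close>
    have "[pw 6 = tau 3 (pw 3)] (mod m)" using pw_add[of 3 3] by simp
    also have "[tau 3 (pw 3) = tau 3 c] (mod m)"
      by (rule tau_cong_right) (simp add: c_def \<open>m = 8\<close>)
    also have "[tau 3 c = h' * (pw 3 + pw (f 3)) + pw 3] (mod m)"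
      unfolding h' by (rule tau_odd[OF ff])
    also have "[h' * (pw 3 + pw (f 3)) + pw 3 = h' * (c + a) + c] (mod m)"
      using pw_f3 abc(1) by (intro cong_add cong_mult cong_refl) (simp_all add: c_def \<open>m = 8\<close> cong_def)
    finally show ?thesis using pw_mod[of 6 2] by (simp add: b_def cong_def \<open>m = 8\<close>)
  qed
  moreover have "a < 8" "b < 8" "c < 8" by (simp_all add: a_def b_def c_def)
  then have "h \<in> {0, 1, 2, 3}" "h' \<in> {0, 1, 2, 3}" using h h' by auto
  ultimately have "b = 5" "odd h"
    using \<open>a \<noteq> 1\<close> \<open>b \<noteq> 1\<close> \<open>c \<noteq> 1\<close> \<open>a \<noteq> b\<close> \<open>a \<noteq> c\<close> \<open>b \<noteq> c\<close> h h' by auto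
  define i' where "i' = int h * s"
  have "odd i'" using \<open>odd h\<close> \<open>odd s\<close> by (simp add: i'_def)
  have f_pw1: "[(f ^^ pw 1) y = f y + i' * T y] (mod n)" for y
  proof -
    have "[(f ^^ pw 1) y = (f ^^ a) y] (mod n)"
      by (rule funpow_exp_cong) (simp add: a_def \<open>m = 8\<close>)
    from cong_trans[OF this] f_odd[of h y] show ?thesis
      by (simp add: h i'_def mult.assoc)
  qed
  have f_pw2: "[(f ^^ pw 2) 1 = f 1 + 8] (mod n)"
  proof -
    have "[(f ^^ pw 2) 1 = (f ^^ 5) 1] (mod n)"
      by (rule funpow_exp_cong) (use \<open>b = 5\<close> in \<open>simp add: b_def \<open>m = 8\<close> cong_def\<close>)
    moreover have "[(f ^^ 5) 1 = f 1 + 2 * (s * T 1)] (mod n)"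
      using f_odd[of 2 1] by simp
    moreover have "[f 1 + 2 * (s * T 1) = f 1 + 8] (mod n)"
    proof -
      have "odd (s * z)" using \<open>odd s\<close> \<open>odd z\<close> by simp
      then obtain u where u: "s * z = 2 * u + 1" by (elim oddE)
      have "2 * (s * T 1) = 8 * (s * z)" by (simp add: z)
      with u have "f 1 + 2 * (s * T 1) - (f 1 + 8) = 16 * u" by linarith
      then show ?thesis unfolding cong_iff_dvd_diff n by (metis dvd_triv_left)
    qed
    ultimately show ?thesis by (meson cong_trans)
  qed
  \<comment> \<open>Both sides are \<open>f 3\<close>; comparing them pins \<open>i' * T 2\<close>
    to 8 modulo 16, which will force \<open>y\<close> to be odd.\<close>
  have "[f 1 + (f 2 + i' * T 2) = f 2 + (f 1 + 8)] (mod n)"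
  proof -
    have "[f 1 + (f 2 + i' * T 2) = f 1 + (f ^^ pw 1) 2] (mod n)"
      by (intro cong_add cong_refl cong_sym[OF f_pw1])
    also have "[f 1 + (f ^^ pw 1) 2 = f (1 + 2)] (mod n)" by (rule cong_sym[OF f_add])
    also have "[f (1 + 2) = f 2 + (f ^^ pw 2) 1] (mod n)" using f_add[of 2 1] by simp
    also have "[f 2 + (f ^^ pw 2) 1 = f 2 + (f 1 + 8)] (mod n)"
      by (intro cong_add cong_refl f_pw2)
    finally show ?thesis .
  qed
  then have T2: "16 dvd i' * T 2 - 8" by (simp add: n cong_iff_dvd_diff)
  obtain y where y: "f 2 = 4 * y + 2" using f2 by (metis mult_div_mod_eq)
  have "[f (f 2) = s * (4 * y) + f 2] (mod n)"
  proof -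
    have "[f (4 * y + 2) = f (4 * y) + f 2] (mod n)"
      using kernel_funpow_add[of "4 * y" 1 2] by (simp add: r)
    also have "[f (4 * y) + f 2 = s * (4 * y) + f 2] (mod n)"
      by (intro cong_add cong_refl f_kernel) (simp add: r)
    finally show ?thesis by (simp add: y)
  qed
  then have "16 dvd T 2 - 4 * (y * (1 + s))"
    by (simp add: T_def n cong_iff_dvd_diff y algebra_simps)
  then have "16 dvd i' * (T 2 - 4 * (y * (1 + s)))" by simp
  with T2 have "16 dvd (i' * T 2 - 8) - i' * (T 2 - 4 * (y * (1 + s)))" by (rule dvd_diff)
  then have "16 dvd 4 * (i' * y * (1 + s)) - 8" by (simp add: algebra_simps)
  then have *: "4 dvd i' * y * (1 + s) - 2" by presburger
  have "odd y"
  proof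
    assume "even y"
    then have "2 * 2 dvd i' * y * (1 + s)" using \<open>odd s\<close> by (intro mult_dvd_mono) auto
    from dvd_diff[OF this[simplified] *] show False by simp
  qed
  \<comment> \<open>Expanding \<open>f 2\<close> as \<open>f (1 + 1)\<close> forces the opposite
    parity of \<open>y\<close>.\<close>
  have "[f 2 = f 1 + (f 1 + i' * T 1)] (mod n)"
    using cong_trans[OF f_add[of 1 1] cong_add[OF cong_refl f_pw1]] by simp
  moreover obtain w where w: "f 1 = 4 * w + 3" using f1 by (metis mult_div_mod_eq)
  ultimately have "16 dvd 4 * y + 2 - (8 * w + 6 + 4 * (i' * z))"
    by (simp add: n cong_iff_dvd_diff y z algebra_simps)
  moreover have "odd (i' * z)" using \<open>odd i'\<close> \<open>odd z\<close> by simp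
  then obtain v where "i' * z = 2 * v + 1" by (elim oddE)
  ultimately have "16 dvd 4 * y + 2 - (8 * w + 6 + 4 * (2 * v + 1))" by simp
  then have "even y" by presburger
  with \<open>odd y\<close> show False by contradiction
qed

end

theorem smooth_if_restricted:
  assumes "cyclic_skew n f pw" "\<not> 32 dvd n" "\<And>p. prime p \<Longrightarrow> odd p \<Longrightarrow> \<not> (int p)\<^sup>2 dvd n"
  shows "[pw (f x) = pw x] (mod period n f)"
  using assms
proof (induction "nat n" arbitrary: n rule: less_induct)
  case less
  interpret cyclic_skew n f pw by (rule less.prems)
  show ?case
  proof (cases "n = 1 \<or> [f 1 = 1] (mod r)")
    case True
    then show ?thesis
    proof
      assume "n = 1"
      then have "m dvd 1" unfolding fix_iff[symmetric] by simp
      then show ?thesis by simp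
    qed (rule smooth_if_trivial_mod_r)
  next
    case False
    then have "r < n" using n_pos by (intro r_less_n) simp
    have IH: "[pw (f x) = pw x] (mod period d f)"
      if "cyclic_skew d f pw" "d dvd n" "d < n" for d
    proof (rule less.hyps[OF _ that(1)])
      show "nat d < nat n" using that(3) n_pos by simp
      show "\<not> 32 dvd d" using less.prems(2) that(2) by (meson dvd_trans)
      show "\<not> (int p)\<^sup>2 dvd d" if "prime p" "odd p" for p
        using less.prems(3)[OF that] \<open>d dvd n\<close> by (meson dvd_trans)
    qed
    show ?thesis
    proof (rule cong_prime_powers_imp_cong[OF m_pos])
      fix p :: nat assume p: "prime p"
      let ?P = "p ^ multiplicity p m"
      show "[pw (f x) = pw x] (mod ?P)"
      proof (cases "?P dvd period r f")
        case True
        with IH[OF skew_r r_dvd_n \<open>r < n\<close>] show ?thesis by (rule cong_dvd_modulus_nat)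
      next
        case not_dvd: False
        then have "period r f dvd m div p"
          using p by (intro dvd_div_prime period_dvd skew_r r_dvd_n)
        then have trivial: "[(f ^^ (m div p)) x = x] (mod r)" for x
          using cyclic_skew.fix_iff[OF skew_r] by blast
        have pm: "p dvd m"
          using not_dvd by (metis not_dvd_imp_multiplicity_0 one_dvd power_0)
        show ?thesis
        proof (cases "int p dvd r")
          case False
          interpret averaging n f pw p 1
            using p pm trivial False by unfold_locales auto
          show ?thesis using pw_f[of x] by (simp add: a_def)
        next
          case pr: True
          show ?thesis
          proof (cases "\<forall>k. r dvd k \<longrightarrow> [(f ^^ (m div p)) k = k] (mod n)")
            case False
            then obtain k where "r dvd k" "\<not> [(f ^^ (m div p)) k = k] (mod n)" by blast
            from pw_cong_1_if_kernel_moved[OF p this]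
            show ?thesis by (rule cong_trans) (rule cong_sym, rule pw_cong_1_if_kernel_moved[OF p \<open>r dvd k\<close>], fact)
          next
            case True
            define k where "k = (f ^^ (m div p)) 1 - 1"
            have k: "r dvd k" "n dvd int p * k" "\<not> n dvd k"
              using kernel_translation[OF p pm trivial] True by (auto simp: k_def)
            have nr: "n = r * (n div r)" using r_dvd_n by simp
            \<comment> \<open>Dividing \<open>k\<close> by \<open>r\<close> gives an element of
              order \<open>p\<close> modulo \<open>n div r\<close>.\<close>
            have pN: "int p dvd n div r"
            proof (rule ccontr)
              assume "\<not> int p dvd n div r"
              then have "coprime (n div r) (int p)"
                using p by (simp add: prime_imp_coprime coprime_commute)
              moreover obtain k' where k': "k = r * k'" using k(1) by (elim dvdE)
              have "r * (n div r) dvd r * (int p * k')"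
                using k(2) nr unfolding k' by (simp add: mult.left_commute)
              then have "n div r dvd int p * k'" using r_pos by simp
              ultimately have "n div r dvd k'" by (simp add: coprime_dvd_mult_right_iff)
              then have "r * (n div r) dvd r * k'" by simp
              then show False using k(3) nr unfolding k' by simp
            qed
            then have "(int p)\<^sup>2 dvd n"
              unfolding power2_eq_square using pr by (subst nr) (rule mult_dvd_mono)
            then have "p = 2" using less.prems(3)[OF p] p by (metis prime_odd_nat order_le_less prime_ge_2_nat)
            define e where "e = multiplicity 2 n"
            have "n \<noteq> 0" using n_pos by simp
            then obtain n1 where n1: "n = 2 ^ e * n1" "odd n1"
              using multiplicity_decompose'[of n 2] unfolding e_def by (metis odd_one)
            show ?thesis
            proof (cases "n1 = 1")
              case False
              moreover have "n1 > 0" using n1(1) n_pos by (simp add: zero_less_mult_iff)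
              ultimately have "2 ^ e < n" using n1(1) by simp
              have dvd: "2 ^ e dvd n" using n1(1) by simp
              interpret Q: cyclic_skew "2 ^ e" f pw
                using two_part(1)[OF cyclic_skew_axioms] dvd unfolding e_def
                by (intro quotient) auto
              \<comment> \<open>Otherwise \<open>k\<close> vanishes modulo \<open>2 ^ e\<close>. It
                also vanishes modulo the odd \<open>n1\<close>, since \<open>2 * k\<close> does, so
                \<open>n\<close> would divide \<open>k\<close>.\<close>
              have "?P dvd period (2 ^ e) f"
              proof (rule ccontr)
                assume "\<not> ?P dvd period (2 ^ e) f"
                then have "period (2 ^ e) f dvd m div p"
                  by (intro dvd_div_prime p period_dvd Q.cyclic_skew_axioms dvd)
                then have "2 ^ e dvd k"
                  using Q.fix_iff unfolding k_def cong_iff_dvd_diff by blast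
                moreover have "n1 dvd 2 * k" using k(2) n1(1) \<open>p = 2\<close> by (metis dvd_mult_right dvd_trans dvd_triv_right of_nat_numeral)
                then have "n1 dvd k" using n1(2) by (simp add: coprime_dvd_mult_right_iff)
                moreover have "coprime (2 ^ e) n1" using n1(2) by simp
                ultimately have "n dvd k" unfolding n1(1) by (intro divides_mult)
                with k(3) show False by contradiction
              qed
              with IH[OF Q.cyclic_skew_axioms dvd \<open>2 ^ e < n\<close>] show ?thesis
                by (rule cong_dvd_modulus_nat)
            next
              case True
              then have n2: "n = 2 ^ e" using n1(1) by simp
              have "even r" using pr \<open>p = 2\<close> by simp
              obtain g where g: "r = 2 ^ g" using r_dvd_n r_pos unfolding n2 by (rule dvd_two_power)
              have "e < 5"
              proof (rule ccontr)
                assume "\<not> e < 5"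
                then have "(2::int) ^ 5 dvd 2 ^ e" by (intro le_imp_power_dvd) simp
                then show False using less.prems(2) n2 by simp
              qed
              have "(2::int) ^ g < 2 ^ e" unfolding g[symmetric] n2[symmetric] by (rule \<open>r < n\<close>)
              then have "g < e" by simp
              have "g \<noteq> 0" using \<open>even r\<close> g by (intro notI) simp
              have "e \<noteq> Suc g" using two_power_index[OF n2 \<open>even r\<close>] g n2 by (intro notI) simp
              \<comment> \<open>All odd numbers agree modulo 2, so \<open>r = 2\<close> belongs to
                the trivial case already excluded.\<close>
              have "g \<noteq> 1"
              proof
                assume "g = 1"
                then have "r = 2" using g by simp
                have "odd (f 1)"
                  using two_power_orbit_odd[OF n2, of 1 1] \<open>g < e\<close> by simp
                then have "[f 1 = 1] (mod r)" unfolding \<open>r = 2\<close> cong_iff_dvd_diff by simp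
                with \<open>\<not> (n = 1 \<or> [f 1 = 1] (mod r))\<close> show False by blast
              qed
              have "g = 2" "e = 4"
                using \<open>e < 5\<close> \<open>g < e\<close> \<open>g \<noteq> 0\<close> \<open>e \<noteq> Suc g\<close> \<open>g \<noteq> 1\<close> by auto
              then have "[f 1 = 1] (mod r)" using g n2 by (intro index_four) simp_all
              with \<open>\<not> (n = 1 \<or> [f 1 = 1] (mod r))\<close> show ?thesis by blast
            qed
          qed
        qed
      qed
    qed
  qed
qed

section \<open>Skew morphisms of cyclic groups\<close>

lemma BijGroup_pow_apply:
  assumes "\<phi> \<in> Bij S" "x \<in> S"
  shows "(\<phi> [^]\<^bsub>BijGroup S\<^esub> (k::nat)) x = (\<phi> ^^ k) x"
  using assms(2)
proof (induction k arbitrary: x)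
  case 0
  then show ?case by (simp add: BijGroup_def)
next
  case (Suc k)
  interpret B: group "BijGroup S" by (rule group_BijGroup)
  have "\<phi> [^]\<^bsub>BijGroup S\<^esub> k \<in> Bij S"
    using B.nat_pow_closed[of \<phi> k] assms(1) by (simp add: carrier_BijGroup)
  moreover have "\<phi> x \<in> S" using Bij_imp_funcset[OF assms(1)] Suc.prems by blast
  moreover have "g \<otimes>\<^bsub>BijGroup S\<^esub> \<phi> = compose S g \<phi>" if "g \<in> Bij S" for g
    using that assms(1) by (simp add: BijGroup_def)
  ultimately show ?case
    using Suc by (simp add: compose_def funpow_Suc_right del: funpow.simps)
qed

lemma funpow_Bij_closed:
  assumes "\<phi> \<in> Bij S" "x \<in> S"
  shows "(\<phi> ^^ k) x \<in> S"
  using assms(2) Bij_imp_funcset[OF assms(1)] by (induction k) auto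

lemma BijGroup_pow_eq_one_iff:
  assumes "\<phi> \<in> Bij S"
  shows "group.ord (BijGroup S) \<phi> dvd k \<longleftrightarrow> (\<forall>x\<in>S. (\<phi> ^^ k) x = x)"
proof -
  interpret B: group "BijGroup S" by (rule group_BijGroup)
  have pow: "\<phi> [^]\<^bsub>BijGroup S\<^esub> k \<in> Bij S"
    using B.nat_pow_closed[of \<phi> k] assms by (simp add: carrier_BijGroup)
  have one: "\<one>\<^bsub>BijGroup S\<^esub> = (\<lambda>x\<in>S. x)" by (simp add: BijGroup_def)
  have "\<phi> [^]\<^bsub>BijGroup S\<^esub> k = \<one>\<^bsub>BijGroup S\<^esub> \<longleftrightarrow> (\<forall>x\<in>S. (\<phi> ^^ k) x = x)"
  proof
    assume "\<forall>x\<in>S. (\<phi> ^^ k) x = x"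
    then show "\<phi> [^]\<^bsub>BijGroup S\<^esub> k = \<one>\<^bsub>BijGroup S\<^esub>"
      by (intro extensionalityI[OF Bij_imp_extensional[OF pow]])
         (auto simp: BijGroup_pow_apply[OF assms] one)
  next
    assume "\<phi> [^]\<^bsub>BijGroup S\<^esub> k = \<one>\<^bsub>BijGroup S\<^esub>"
    then have "(\<phi> [^]\<^bsub>BijGroup S\<^esub> k) x = x" if "x \<in> S" for x
      using that by (simp add: one)
    then show "\<forall>x\<in>S. (\<phi> ^^ k) x = x" by (simp add: BijGroup_pow_apply[OF assms])
  qed
  then show ?thesis
    using B.pow_eq_id[of \<phi> k] assms by (simp add: carrier_BijGroup)
qed

lemma ord_BijGroup_pos:
  assumes "finite S" "\<phi> \<in> Bij S"
  shows "group.ord (BijGroup S) \<phi> > 0"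
proof -
  interpret B: group "BijGroup S" by (rule group_BijGroup)
  have "Bij S \<subseteq> S \<rightarrow>\<^sub>E S" by (auto simp: PiE_def Bij_imp_extensional dest: Bij_imp_funcset)
  from finite_subset[OF this] have "finite (Bij S)" using assms(1) by (simp add: finite_PiE)
  then show ?thesis
    using B.ord_ge_1[of \<phi>] assms(2) by (simp add: carrier_BijGroup)
qed

text \<open>Reducing the integer exponents modulo the order gives natural exponents for the same
  powers. That the order divides \<open>period\<close> lets congruences of \<open>pw\<close> be
  carried back.\<close>

lemma skew_morphism_imp_cyclic_skew:
  fixes n :: nat and \<phi> :: "int \<Rightarrow> int"
  defines "S \<equiv> {0..<int n}"
  assumes "n > 0" and \<phi>: "\<phi> \<in> Bij S" and zero: "\<phi> 0 = 0"
    and \<pi>: "power_function (integer_mod_group n) \<phi> \<pi>"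
  defines "f \<equiv> \<lambda>x. \<phi> (x mod int n)"
    and "pw \<equiv> \<lambda>x. nat (\<pi> (x mod int n) mod int (group.ord (BijGroup S) \<phi>))"
  shows "cyclic_skew (int n) f pw"
    and "group.ord (BijGroup S) \<phi> dvd period (int n) f"
proof -
  interpret B: group "BijGroup S" by (rule group_BijGroup)
  let ?o = "group.ord (BijGroup S) \<phi>"
  have carrier: "carrier (integer_mod_group n) = S"
    using \<open>n > 0\<close> by (simp add: carrier_integer_mod_group S_def)
  have mod_S: "x mod int n \<in> S" for x using \<open>n > 0\<close> by (simp add: S_def)
  have S_mod: "x mod int n = x" if "x \<in> S" for x using that by (simp add: S_def)
  have \<phi>_S: "(\<phi> ^^ k) x \<in> S" if "x \<in> S" for x k by (rule funpow_Bij_closed[OF \<phi> that])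
  have f_pow: "(f ^^ k) x mod int n = (\<phi> ^^ k) (x mod int n)" for k x
  proof (induction k)
    case (Suc k)
    then show ?case using S_mod[OF \<phi>_S[OF mod_S, of "Suc k"]] by (simp add: f_def)
  qed simp
  have "?o > 0" by (rule ord_BijGroup_pos[OF _ \<phi>]) (simp add: S_def)
  have pow_pi: "(\<phi> [^]\<^bsub>BijGroup S\<^esub> \<pi> (a mod int n)) b = (\<phi> ^^ pw a) b" if "b \<in> S" for a b
  proof -
    have "int (pw a) = \<pi> (a mod int n) mod int ?o"
      using \<open>?o > 0\<close> by (simp add: pw_def)
    then have "int ?o dvd int (pw a) - \<pi> (a mod int n)"
      by (metis cong_iff_dvd_diff cong_mod_left cong_refl)
    then have "\<phi> [^]\<^bsub>BijGroup S\<^esub> \<pi> (a mod int n) = \<phi> [^]\<^bsub>BijGroup S\<^esub> int (pw a)"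
      using B.int_pow_eq[of \<phi>] \<phi> by (metis carrier_BijGroup dvd_diff_commute)
    then show ?thesis using that by (simp add: int_pow_int BijGroup_pow_apply[OF \<phi>])
  qed
  show skew: "cyclic_skew (int n) f pw"
  proof
    show "int n > 0" using \<open>n > 0\<close> by simp
    show "[f 0 = 0] (mod int n)" using zero by (simp add: f_def)
    show "[f a = f b] (mod int n)" if "[a = b] (mod int n)" for a b
      using that by (simp add: f_def cong_def)
    show "\<exists>i>0. \<forall>x. [(f ^^ i) x = x] (mod int n)"
      using \<open>?o > 0\<close> BijGroup_pow_eq_one_iff[OF \<phi>, of ?o] mod_S by (auto simp: cong_def f_pow)
    show "[f (a + b) = f a + (f ^^ pw a) b] (mod int n)" for a b
    proof -
      have "f (a + b) = \<phi> ((a mod int n + b mod int n) mod int n)"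
        by (simp add: f_def mod_add_eq)
      also have "\<dots> = (\<phi> (a mod int n) + (\<phi> ^^ pw a) (b mod int n)) mod int n"
        using \<pi>[unfolded power_function_def carrier, rule_format, OF mod_S mod_S, of a b]
          pow_pi[OF mod_S, of a b] by simp
      also have "\<dots> = (f a + (f ^^ pw a) b) mod int n"
        unfolding f_pow[symmetric] by (simp add: f_def mod_simps)
      finally show ?thesis by (simp add: cong_def)
    qed
  qed
  interpret cyclic_skew "int n" f pw by (rule skew)
  have "(\<phi> ^^ m) x = x" if "x \<in> S" for x
    using f_pow[of m x] funpow_m[of x] S_mod[OF that] by (simp add: cong_def)
  then show "?o dvd period (int n) f" by (simp add: BijGroup_pow_eq_one_iff[OF \<phi>])
qed

lemma smooth_if_cyclic_skew_smooth:
  assumes "n > 0" "skew_morphism (integer_mod_group n) \<phi>"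
    and smooth: "\<And>f pw x. cyclic_skew (int n) f pw \<Longrightarrow> [pw (f x) = pw x] (mod period (int n) f)"
  shows "smooth (integer_mod_group n) \<phi>"
proof -
  let ?S = "{0..<int n}" and ?o = "perm_order (integer_mod_group n) \<phi>"
  have carrier: "carrier (integer_mod_group n) = ?S"
    using \<open>n > 0\<close> by (simp add: carrier_integer_mod_group)
  from assms(2) obtain \<pi> where \<phi>: "\<phi> \<in> Bij ?S" and zero: "\<phi> 0 = 0"
    and \<pi>: "power_function (integer_mod_group n) \<phi> \<pi>"
    unfolding skew_morphism_def by (auto simp: carrier carrier_BijGroup)
  define f where "f = (\<lambda>x. \<phi> (x mod int n))"
  define pw where "pw = (\<lambda>x. nat (\<pi> (x mod int n) mod int ?o))"
  note skew = skew_morphism_imp_cyclic_skew[OF assms(1) \<phi> zero \<pi>, folded f_def carrier, folded pw_def]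
  have "?o > 0" unfolding carrier by (rule ord_BijGroup_pos[OF _ \<phi>]) simp
  have "[\<pi> (\<phi> a) = \<pi> a] (mod int ?o)" if "a \<in> ?S" for a
  proof -
    have "\<phi> a \<in> ?S" using Bij_imp_funcset[OF \<phi>] that by blast
    with that have eq: "f a = \<phi> a" "int (pw a) = \<pi> a mod int ?o" "int (pw (\<phi> a)) = \<pi> (\<phi> a) mod int ?o"
      using \<open>?o > 0\<close> by (simp_all add: f_def pw_def)
    have "[pw (f a) = pw a] (mod ?o)"
      using smooth[OF skew(1)] skew(2) by (rule cong_dvd_modulus_nat)
    then have "[int (pw (\<phi> a)) = int (pw a)] (mod int ?o)" by (simp only: cong_int_iff eq(1))
    then show ?thesis by (simp add: eq cong_def)
  qed
  then show ?thesis
    unfolding smooth_def using assms(2) \<pi> carrier by blast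
qed

section \<open>A family of nonsmooth skew morphisms\<close>

lemma nonsmooth_skew_morphism:
  fixes n :: nat and c :: int
  assumes "n > 0" "c dvd int n" "int n dvd c * c" "odd c \<or> 2 * int n dvd c * c" "\<not> int n dvd 2 * c"
  shows "\<exists>\<phi>. skew_morphism (integer_mod_group n) \<phi> \<and> \<not> smooth (integer_mod_group n) \<phi>"
proof -
  define N where "N = int n"
  define S where "S = {0..<N}"
  have "N > 0" using \<open>n > 0\<close> by (simp add: N_def)
  define T :: "int \<Rightarrow> int" where "T x = x * (x - 1) div 2" for x
  have T2: "2 * T x = x * (x - 1)" for x by (simp add: T_def)
  have T_add: "T (x + y) = T x + T y + x * y" for x y
    using T2[of x] T2[of y] T2[of "x + y"] by (simp add: algebra_simps)
  have T_minus: "T (- x) = T x + x" for x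
    using T2[of x] T2[of "- x"] by (simp add: algebra_simps)
  \<comment> \<open>Halving in \<open>T\<close> costs a factor 2: an odd \<open>c\<close> makes
    \<open>z * (c * z - 1)\<close> even, otherwise the stronger divisibility of \<open>c * c\<close>
    supplies it.\<close>
  have "N dvd c * T (c * z)" for z
    using assms(4)
  proof
    assume "odd c"
    then have "even (z * (c * z - 1))" by simp
    then obtain u where u: "z * (c * z - 1) = 2 * u" by (elim evenE)
    have "2 * (c * T (c * z)) = c * c * (z * (c * z - 1))"
      unfolding mult.left_commute[of 2] T2 by (simp add: algebra_simps)
    then have eq: "c * T (c * z) = c * c * u" unfolding u by simp
    show ?thesis unfolding eq using assms(3) by (simp add: N_def)
  next
    assume "2 * int n dvd c * c"
    then have "2 * N dvd c * c * (z * (c * z - 1))" by (simp add: N_def)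
    also have "\<dots> = 2 * (c * T (c * z))"
      unfolding mult.left_commute[of 2] T2 by (simp add: algebra_simps)
    finally show ?thesis by simp
  qed
  moreover have "c * T (y + c * z) - c * T y = c * T (c * z) + c * c * (y * z)" for y z
    by (simp add: T_add algebra_simps)
  ultimately have cT_c: "[c * T (y + c * z) = c * T y] (mod N)" for y z
    using assms(3) by (simp add: cong_iff_dvd_diff N_def)
  have cT: "[c * T x = c * T y] (mod N)" if "[x = y] (mod N)" for x y
  proof -
    have "c dvd x - y" using that assms(2) by (auto simp: cong_iff_dvd_diff N_def)
    then obtain z where "x - y = c * z" by (elim dvdE)
    with cT_c[of y z] show ?thesis by (simp add: algebra_simps)
  qed
  define h where "h x = - x + c * T x" for x
  have h_cong: "[h x = h y] (mod N)" if "[x = y] (mod N)" for x y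
    unfolding h_def using that by (intro cong_add cT) (simp_all add: cong_minus_minus_iff)
  have hh: "[h (h x) = (1 + c) * x] (mod N)" for x
  proof -
    have "[- h x + c * T (- x + c * T x) = - h x + c * T (- x)] (mod N)"
      by (intro cong_add cong_refl cT_c)
    also have "- h x + c * T (- x) = (1 + c) * x"
      by (simp add: h_def T_minus algebra_simps)
    finally show ?thesis by (simp add: h_def)
  qed
  define \<phi> where "\<phi> = (\<lambda>x\<in>S. h x mod N)"
  have mod_S: "x mod N \<in> S" for x using \<open>N > 0\<close> by (simp add: S_def)
  have \<phi>_S: "\<phi> x \<in> S" "\<phi> x = h x mod N" if "x \<in> S" for x
    using that \<open>N > 0\<close> by (simp_all add: \<phi>_def S_def)
  have \<phi>\<phi>: "\<phi> (\<phi> x) = (1 + c) * x mod N" if "x \<in> S" for x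
    using that h_cong[of "h x mod N" "h x"] hh[of x] by (simp add: \<phi>_S mod_S cong_def)
  have "inj_on \<phi> S"
  proof (rule inj_onI)
    fix x y assume xy: "x \<in> S" "y \<in> S" "\<phi> x = \<phi> y"
    then have "[(1 + c) * x = (1 + c) * y] (mod N)" using \<phi>\<phi> by (metis cong_def)
    \<comment> \<open>\<open>1 - c\<close> inverts \<open>1 + c\<close>, as \<open>c * c\<close>
      vanishes modulo \<open>N\<close>.\<close>
    then have "N dvd (1 - c) * ((1 + c) * x - (1 + c) * y)"
      unfolding cong_iff_dvd_diff by (rule dvd_mult)
    moreover have "N dvd c * c * (x - y)" using assms(3) by (simp add: N_def)
    ultimately have "N dvd (1 - c) * ((1 + c) * x - (1 + c) * y) + c * c * (x - y)" by (rule dvd_add)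
    also have "\<dots> = x - y" by (simp add: algebra_simps)
    finally have "[x = y] (mod N)" by (simp add: cong_iff_dvd_diff)
    with xy(1,2) show "x = y" by (auto simp: S_def cong_def)
  qed
  moreover have "\<phi> ` S \<subseteq> S" using \<phi>_S by auto
  ultimately have \<phi>_Bij: "\<phi> \<in> Bij S"
    unfolding Bij_def bij_betw_def using endo_inj_surj[of S \<phi>] by (simp add: S_def \<phi>_def)
  have pow_even: "(\<phi> ^^ (2 * k)) x = (1 + int k * c) * x mod N" if "x \<in> S" for x k
  proof (induction k)
    case 0
    then show ?case using that by (simp add: S_def)
  next
    case (Suc k)
    have "(\<phi> ^^ (2 * Suc k)) x = (1 + c) * ((1 + int k * c) * x mod N) mod N"
      using \<phi>\<phi>[OF mod_S, of "(1 + int k * c) * x"] Suc by simp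
    also have "\<dots> = (1 + c) * ((1 + int k * c) * x) mod N" by (simp add: mod_mult_right_eq)
    also have "(1 + c) * ((1 + int k * c) * x) = (1 + int (Suc k) * c) * x + c * c * (int k * x)"
      by (simp add: algebra_simps)
    also have "\<dots> mod N = (1 + int (Suc k) * c) * x mod N"
      unfolding mod_eq_dvd_iff using assms(3) by (simp add: N_def)
    finally show ?case .
  qed
  \<comment> \<open>\<open>1 - 2 * x\<close> modulo the order, made nonnegative on \<open>S\<close>\<close>
  define \<pi> where "\<pi> x = 1 + 2 * (x * (N - 1))" for x
  have carrier: "carrier (integer_mod_group n) = S"
    using \<open>n > 0\<close> by (simp add: carrier_integer_mod_group S_def N_def)
  have power: "power_function (integer_mod_group n) \<phi> \<pi>"
    unfolding power_function_def carrier
  proof (intro ballI)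
    fix a b assume ab: "a \<in> S" "b \<in> S"
    define k where "k = nat (a * (N - 1))"
    have k: "int k = a * (N - 1)" using ab(1) \<open>N > 0\<close> by (simp add: k_def S_def)
    have "\<pi> a = int (Suc (2 * k))" by (simp add: \<pi>_def k)
    then have "(\<phi> [^]\<^bsub>BijGroup S\<^esub> \<pi> a) b = (\<phi> ^^ Suc (2 * k)) b"
      by (simp only: int_pow_int BijGroup_pow_apply[OF \<phi>_Bij ab(2)])
    also have "\<dots> = h ((1 + int k * c) * b mod N) mod N"
      by (simp add: pow_even[OF ab(2)] \<phi>_S mod_S)
    finally have pow: "[(\<phi> [^]\<^bsub>BijGroup S\<^esub> \<pi> a) b = h ((1 + int k * c) * b mod N)] (mod N)"
      by (simp add: cong_def)
    \<comment> \<open>\<open>k\<close> is \<open>- a\<close> modulo \<open>N\<close>; under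
      \<open>h\<close> the term \<open>- a * b * c\<close> becomes the cross term of
      \<open>c * T (a + b)\<close>.\<close>
    have "(1 + int k * c) * b - (b + c * (- (a * b))) = N * (a * b * c)"
      by (simp add: k algebra_simps)
    then have "[(1 + int k * c) * b = b + c * (- (a * b))] (mod N)"
      unfolding cong_iff_dvd_diff by (metis dvd_triv_left)
    then have "[(1 + int k * c) * b mod N = b + c * (- (a * b))] (mod N)"
      unfolding cong_mod_left .
    from cong_trans[OF pow h_cong[OF this]]
    have "[(\<phi> [^]\<^bsub>BijGroup S\<^esub> \<pi> a) b = h (b + c * (- (a * b)))] (mod N)" .
    also have "[h (b + c * (- (a * b))) = - (b + c * (- (a * b))) + c * T b] (mod N)"
      unfolding h_def by (intro cong_add cong_refl cT_c)
    finally have "[h a + (\<phi> [^]\<^bsub>BijGroup S\<^esub> \<pi> a) b = h a + (- (b + c * (- (a * b))) + c * T b)] (mod N)"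
      by (intro cong_add cong_refl)
    also have "h a + (- (b + c * (- (a * b))) + c * T b) = h (a + b)"
      by (simp add: h_def T_add algebra_simps)
    finally have sum: "[h a + (\<phi> [^]\<^bsub>BijGroup S\<^esub> \<pi> a) b = h (a + b)] (mod N)" .
    have "\<phi> ((a + b) mod N) = h (a + b) mod N"
      using h_cong[of "(a + b) mod N" "a + b"] by (simp add: \<phi>_S mod_S cong_def)
    also have "\<dots> = (\<phi> a + (\<phi> [^]\<^bsub>BijGroup S\<^esub> \<pi> a) b) mod N"
      using sum ab(1) by (simp add: \<phi>_S cong_def mod_add_left_eq)
    finally show "\<phi> (a \<otimes>\<^bsub>integer_mod_group n\<^esub> b) =
        \<phi> a \<otimes>\<^bsub>integer_mod_group n\<^esub> (\<phi> [^]\<^bsub>BijGroup S\<^esub> \<pi> a) b"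
      by (simp add: N_def)
  qed
  have "\<phi> 0 = 0" using \<open>N > 0\<close> by (simp add: \<phi>_def S_def h_def T_def)
  then have "skew_morphism (integer_mod_group n) \<phi>"
    unfolding skew_morphism_def using power \<phi>_Bij by (auto simp: carrier carrier_BijGroup)
  moreover have "\<not> smooth (integer_mod_group n) \<phi>"
  proof
    assume "smooth (integer_mod_group n) \<phi>"
    then have smooth: "[\<pi> (\<phi> a) = \<pi> a] (mod int (group.ord (BijGroup S) \<phi>))" if "a \<in> S" for a
      using that power by (simp add: smooth_iff_all carrier)
    let ?o = "group.ord (BijGroup S) \<phi>"
    have "N \<noteq> 1" using assms(5) by (auto simp: N_def)
    then have "1 \<in> S" using \<open>N > 0\<close> by (simp add: S_def)
    have "(- 1) mod N = N - 1" using \<open>N > 0\<close> \<open>N \<noteq> 1\<close> by (simp add: zmod_minus1)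
    then have "\<phi> 1 = N - 1" using \<phi>_S(2)[OF \<open>1 \<in> S\<close>] by (simp add: h_def T_def)
    with smooth[OF \<open>1 \<in> S\<close>] have "int ?o dvd \<pi> (N - 1) - \<pi> 1" by (simp add: cong_iff_dvd_diff)
    moreover have "?o dvd 2 * n"
      unfolding BijGroup_pow_eq_one_iff[OF \<phi>_Bij]
    proof
      fix x assume x: "x \<in> S"
      have "(1 + int n * c) * x = x + N * (c * x)" by (simp add: N_def algebra_simps)
      with pow_even[OF x, of n] x show "(\<phi> ^^ (2 * n)) x = x" by (simp add: S_def)
    qed
    then have "int ?o dvd 2 * N" unfolding N_def by (metis int_dvd_int_iff of_nat_mult of_nat_numeral)
    \<comment> \<open>This multiple of the order is chosen to cut
      \<open>\<pi> (N - 1) - \<pi> 1\<close> down to 4.\<close>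
    then have "int ?o dvd 2 * N * (N - 3)" by simp
    ultimately have "int ?o dvd (\<pi> (N - 1) - \<pi> 1) - 2 * N * (N - 3)" by (rule dvd_diff)
    also have "(\<pi> (N - 1) - \<pi> 1) - 2 * N * (N - 3) = int 4"
      by (simp add: \<pi>_def algebra_simps)
    finally have "?o dvd 2 * 2" unfolding int_dvd_int_iff by simp
    then have "(\<phi> ^^ (2 * 2)) 1 = 1"
      using BijGroup_pow_eq_one_iff[OF \<phi>_Bij] \<open>1 \<in> S\<close> by blast
    then have "(1 + 2 * c) mod N = 1 mod N"
      using pow_even[OF \<open>1 \<in> S\<close>, of 2] \<open>1 \<in> S\<close> by (simp add: S_def)
    then have "N dvd 2 * c" by (simp add: mod_eq_dvd_iff)
    with assms(5) show False by (simp add: N_def)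
  qed
  ultimately show ?thesis by blast
qed

section \<open>The arithmetic condition on \<open>n\<close>\<close>

lemma two_power_times_squarefree_iff:
  fixes n :: nat
  assumes "n > 0"
  shows "(\<exists>e n1. e \<le> 4 \<and> n1 > 0 \<and> odd n1 \<and> squarefree n1 \<and> n = 2 ^ e * n1) \<longleftrightarrow>
    \<not> 32 dvd n \<and> (\<forall>p. prime p \<longrightarrow> odd p \<longrightarrow> \<not> p\<^sup>2 dvd n)"
proof (intro iffI conjI allI impI)
  assume "\<exists>e n1. e \<le> 4 \<and> n1 > 0 \<and> odd n1 \<and> squarefree n1 \<and> n = 2 ^ e * n1"
  then obtain e n1 where n: "e \<le> 4" "n1 > 0" "odd n1" "squarefree n1" "n = 2 ^ e * n1" by blast
  show "\<not> 32 dvd n"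
  proof
    assume "32 dvd n"
    then have "2 ^ 5 dvd 2 ^ e * n1" using n(5) by simp
    moreover have "coprime (2 ^ 5) n1"
      using n(3) by (intro coprime_power_left_iff[THEN iffD2] disjI1) simp
    ultimately have "(2::nat) ^ 5 dvd 2 ^ e" by (simp only: coprime_dvd_mult_left_iff)
    then have "5 \<le> e" by (rule power_dvd_imp_le) simp
    with n(1) show False by simp
  qed
  show "\<not> p\<^sup>2 dvd n" if "prime p" "odd p" for p
  proof
    assume "p\<^sup>2 dvd n"
    moreover have "coprime (p\<^sup>2) (2 ^ e)" using \<open>odd p\<close> by simp
    ultimately have "p\<^sup>2 dvd n1" using n(5) by (simp add: coprime_dvd_mult_right_iff)
    with n(4) have "p dvd 1" by (rule squarefreeD)
    with \<open>prime p\<close> show False by simp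
  qed
next
  assume *: "\<not> 32 dvd n \<and> (\<forall>p. prime p \<longrightarrow> odd p \<longrightarrow> \<not> p\<^sup>2 dvd n)"
  define e where "e = multiplicity 2 n"
  obtain n1 where n1: "n = 2 ^ e * n1" "odd n1"
    using multiplicity_decompose'[of n 2] assms unfolding e_def by (metis less_irrefl odd_one)
  have "e \<le> 4"
  proof (rule ccontr)
    assume "\<not> e \<le> 4"
    then have "(2::nat) ^ 5 dvd 2 ^ e" by (intro le_imp_power_dvd) simp
    then have "32 dvd n" unfolding n1(1) by simp
    with * show False by blast
  qed
  moreover have "squarefree n1"
  proof (rule squarefreeI)
    fix x assume x: "x\<^sup>2 dvd n1"
    show "x dvd 1"
    proof (rule ccontr)
      assume "\<not> x dvd 1"
      then obtain p where p: "prime p" "p dvd x" using prime_factor_nat[of x] by auto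
      then have "p\<^sup>2 dvd n1" using x by (meson dvd_trans dvd_power_same)
      moreover from this have "odd p" using n1(2) by (metis dvd_trans dvd_triv_left power2_eq_square)
      ultimately show False using * p(1) unfolding n1(1) by (metis dvd_mult)
    qed
  qed
  moreover have "n1 > 0" using n1(2) by (rule odd_pos)
  ultimately show "\<exists>e n1. e \<le> 4 \<and> n1 > 0 \<and> odd n1 \<and> squarefree n1 \<and> n = 2 ^ e * n1"
    using n1 by blast
qed

lemma nonsmooth_if_odd_prime_square_dvd:
  assumes "n > 0" "prime p" "odd p" "p\<^sup>2 dvd n"
  shows "\<exists>\<phi>. skew_morphism (integer_mod_group n) \<phi> \<and> \<not> smooth (integer_mod_group n) \<phi>"
proof -
  obtain k where k: "n = p * p * k" using assms(4) by (auto simp: power2_eq_square elim: dvdE)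
  \<comment> \<open>This is \<open>n div p\<close>. For even \<open>k\<close> the extra factor 2 in
    \<open>c * c\<close> comes from \<open>k\<close>; for odd \<open>k\<close>, \<open>c\<close> is
    odd.\<close>
  define c where "c = int p * int k"
  have n: "int n = int p * c" by (simp add: k c_def)
  have cc: "c * c = int n * int k" by (simp add: k c_def)
  have "c > 0" using assms(1) prime_gt_0_nat[OF assms(2)] by (auto simp: c_def k)
  show ?thesis
  proof (rule nonsmooth_skew_morphism[OF assms(1), of c])
    show "c dvd int n" "int n dvd c * c" by (simp add: n, simp add: cc)
    show "odd c \<or> 2 * int n dvd c * c"
    proof (cases "even k")
      case True
      then obtain j where "k = 2 * j" by (elim evenE)
      then have "c * c = 2 * int n * int j" by (simp add: cc)
      then show ?thesis by simp
    next
      case False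
      then show ?thesis using assms(3) by (simp add: c_def)
    qed
    show "\<not> int n dvd 2 * c"
    proof
      assume "int n dvd 2 * c"
      then have "int p dvd int 2" using \<open>c > 0\<close> by (simp add: n)
      then have "p dvd 2" by (simp only: int_dvd_int_iff)
      then have "p = 2" using assms(2) primes_dvd_imp_eq two_is_prime_nat by blast
      with assms(3) show False by simp
    qed
  qed
qed

lemma nonsmooth_if_32_dvd:
  assumes "n > 0" "32 dvd n"
  shows "\<exists>\<phi>. skew_morphism (integer_mod_group n) \<phi> \<and> \<not> smooth (integer_mod_group n) \<phi>"
proof -
  obtain k where k: "n = 32 * k" using assms(2) by (elim dvdE)
  show ?thesis
  proof (rule nonsmooth_skew_morphism[OF assms(1), of "8 * int k"])
    have "int n = 8 * int k * 4" by (simp add: k)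
    then show "8 * int k dvd int n" by (metis dvd_triv_left)
    have "8 * int k * (8 * int k) = 2 * int n * int k" by (simp add: k)
    then show "odd (8 * int k) \<or> 2 * int n dvd 8 * int k * (8 * int k)"
      "int n dvd 8 * int k * (8 * int k)"
      by (metis dvd_triv_left, metis dvd_triv_right dvd_mult_left mult.commute mult.assoc)
    show "\<not> int n dvd 2 * (8 * int k)"
      using assms(1) by (auto simp: k dest: zdvd_imp_le)
  qed
qed

theorem theorem1p1:
  fixes n :: nat
  assumes "n > 0"
  shows "(\<forall>\<phi>. skew_morphism (integer_mod_group n) \<phi> \<longrightarrow> smooth (integer_mod_group n) \<phi>) \<longleftrightarrow>
    (\<exists>e n1 :: nat. e \<le> 4 \<and> n1 > 0 \<and> odd n1 \<and> squarefree n1 \<and> n = 2 ^ e * n1)"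
  unfolding two_power_times_squarefree_iff[OF assms]
proof (intro iffI conjI allI impI)
  assume all: "\<forall>\<phi>. skew_morphism (integer_mod_group n) \<phi> \<longrightarrow> smooth (integer_mod_group n) \<phi>"
  show "\<not> 32 dvd n"
    using nonsmooth_if_32_dvd[OF assms] all by blast
  show "\<not> p\<^sup>2 dvd n" if "prime p" "odd p" for p
    using nonsmooth_if_odd_prime_square_dvd[OF assms that] all by blast
next
  fix \<phi>
  assume n: "\<not> 32 dvd n \<and> (\<forall>p. prime p \<longrightarrow> odd p \<longrightarrow> \<not> p\<^sup>2 dvd n)"
    and skew: "skew_morphism (integer_mod_group n) \<phi>"
  have thirty_two: "\<not> 32 dvd int n"
    using n by (metis int_dvd_int_iff of_nat_numeral)
  have sq: "\<not> (int p)\<^sup>2 dvd int n" if "prime p" "odd p" for p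
    using n that by (simp flip: of_nat_power)
  show "smooth (integer_mod_group n) \<phi>"
    by (rule smooth_if_cyclic_skew_smooth[OF assms skew smooth_if_restricted[OF _ thirty_two sq]])
qed

end
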